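(* Let $V$ be a conformal vertex algebra and $a,b\in V$. Let $f(t)$ be a meromorphic function of a complex variable $t$ which is periodic, $f(t+1)=f(t)$. Let $\tau\in\mathbb H$ and suppose $f$ is analytic in the domain $-\mathrm{Im}\,\tau<\mathrm{Im}\,t<\mathrm{Im}\,\tau$ except possibly at $t=0$ (and hence, by periodicity, at the integers), where it may have a pole. Put $q=e^{2\pi i\tau}$, $z=e^{2\pi it}$ and let $F_+(z)$ (resp. $F_-(z)$) be the Fourier expansion of $f$ in the domain $|q|<|z|<1$ (resp. $1<|z|<|q|^{-1}$). If either $f(t)$ is regular at $t=0$, or $f(t+\tau)=f(t)-\alpha$ for all $t\in\mathbb C$ for some constant $\alpha\in\mathbb C$, then $$2\pi i\,X(a_{[f]}b,w)=\mathrm{res}_z F_-\!\left(\frac zw\right)X(a,z)X(b,w)-\mathrm{res}_zF_+\!\left(\frac zw\right)X(b,w)X(a,z)$$ as an equality in $\mathrm{Hom}(V,V((w)))$.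
   Context: A conformal vertex algebra $(V,\mathbf 1,\omega,Y)$ is $\mathbb Z_{\ge0}$-graded by $L_0$ with finite-dimensional graded pieces, $Y(a,z)=\sum_na_{(n)}z^{-n-1}$. Put $X(a,z)=z^{-1}Y(z^{L_0}a,z)$ and $Y[a,t]=Y(e^{2\pi itL_0}a,e^{2\pi it}-1)$, which is another vertex algebra structure on $V$. For a function $f$ with Laurent expansion $f(t)=\sum_{n\ge N}f_nt^n$ at $t=0$, $a_{[f]}b=\mathrm{res}_tf(t)Y[a,t]b$, where $\mathrm{res}_t$ is the coefficient of $t^{-1}$. The Fourier expansions are $F_\pm(z)=\sum_{n\in\mathbb Z}F^\pm_nz^n$ with $F_\pm(e^{2\pi it})=f(t)$ in the respective domains. Here $\tau$ (hence $q$) is a fixed number, and the coefficients of the resulting infinite sums on the right side are convergent sums of complex numbers/vectors. *)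

theory Defs
  imports
    "HOL-Complex_Analysis.Complex_Analysis"
    "HOL-Computational_Algebra.Formal_Laurent_Series"
    "HOL-Library.Groups_Big_Fun"
begin

section \<open>Conformal vertex algebras\<close>

text \<open>
  \<open>vop V a b\<close> is $Y(a,z)b$. Its type encodes that it lies in $V((z))$: Laurent series with finitely
  many negative powers and coefficients in $V$.
\<close>

record (overloaded) ('v :: ab_group_add) vertex_data =
  vscale :: "complex \<Rightarrow> 'v \<Rightarrow> 'v"
  vac :: 'v
  conf :: 'v
  vop :: "'v \<Rightarrow> 'v \<Rightarrow> 'v fls"

definition mode :: "('v :: ab_group_add) vertex_data \<Rightarrow> 'v \<Rightarrow> int \<Rightarrow> 'v \<Rightarrow> 'v" where
  "mode V a n b = fls_nth (vop V a b) (- n - 1)"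

definition Lop :: "('v :: ab_group_add) vertex_data \<Rightarrow> int \<Rightarrow> 'v \<Rightarrow> 'v" where
  "Lop V n = mode V (conf V) (n + 1)"

definition wt_space :: "('v :: ab_group_add) vertex_data \<Rightarrow> nat \<Rightarrow> 'v set" where
  "wt_space V d = {v. Lop V 0 v = vscale V (of_nat d) v}"

text \<open>
  In the Borcherds identity all three sums have finite support because \<^term>\<open>vop V a b\<close> has
  only finitely many negative powers, so \<^const>\<open>Sum_any\<close> is the genuine sum. The translation
  operator is $Ta = a_{(-2)}\mathbf 1$; the derivative property of $Y(Ta,z)$ follows from the
  Borcherds identity.
\<close>

locale vertex_algebra = vector_space "vscale V"
  for V :: "('v :: ab_group_add) vertex_data" (structure) +
  assumes mode_linear_left: "\<And>n b. Vector_Spaces.linear (vscale V) (vscale V) (\<lambda>a. mode V a n b)"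
    and mode_linear_right: "\<And>a n. Vector_Spaces.linear (vscale V) (vscale V) (mode V a n)"
    and vacuum: "\<And>n b. mode V (vac V) n b = (if n = - 1 then b else 0)"
    and creation: "\<And>a. mode V a (- 1) (vac V) = a"
    and creation_regular: "\<And>a n. n \<ge> 0 \<Longrightarrow> mode V a n (vac V) = 0"
    and borcherds: "\<And>a b c m n k.
      Sum_any (\<lambda>j::nat. vscale V (of_int m gchoose j)
        (mode V (mode V a (n + int j) b) (m + k - int j) c)) =
      Sum_any (\<lambda>j::nat. vscale V ((- 1) ^ j * (of_int n gchoose j))
        (mode V a (m + n - int j) (mode V b (k + int j) c))) -
      Sum_any (\<lambda>j::nat. vscale V ((- 1) ^ j * (of_int n gchoose j) * (- 1) powi n)
        (mode V b (n + k - int j) (mode V a (m + int j) c)))"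

locale conformal_vertex_algebra = vertex_algebra +
  assumes virasoro: "\<exists>c::complex. \<forall>m n v.
      Lop V m (Lop V n v) - Lop V n (Lop V m v) =
      vscale V (of_int (m - n)) (Lop V (m + n) v) +
      (if m + n = 0 then vscale V (of_int (m ^ 3 - m) / 12 * c) v else 0)"
    and translation: "\<And>v. Lop V (- 1) v = mode V v (- 2) (vac V)"
    and graded: "module.span (vscale V) (\<Union>d. wt_space V d) = UNIV"
    and graded_fin_dim:
      "\<And>d. \<exists>B. finite B \<and> wt_space V d \<subseteq> module.span (vscale V) B"


section \<open>Vector-valued Laurent series\<close>

text \<open>The product of a scalar Laurent series with a vector-valued one.\<close>

definition fls_vmult ::
    "('v :: ab_group_add) vertex_data \<Rightarrow> complex fls \<Rightarrow> 'v fls \<Rightarrow> 'v fls" where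
  "fls_vmult V p F = Abs_fls (\<lambda>k. Sum_any (\<lambda>i. vscale V (fls_nth p i) (fls_nth F (k - i))))"

text \<open>The substitution $F(g(t))$, meaningful when $g$ has positive order.\<close>

definition fls_vsubst ::
    "('v :: ab_group_add) vertex_data \<Rightarrow> 'v fls \<Rightarrow> complex fls \<Rightarrow> 'v fls" where
  "fls_vsubst V F g = Abs_fls (\<lambda>k. Sum_any (\<lambda>j. vscale V (fls_nth (g powi j) k) (fls_nth F j)))"

text \<open>The arguments of \<^const>\<open>Abs_fls\<close> above are Laurent series, so it introduces no junk.\<close>

lemma fls_nth_vmult:
  assumes "vector_space (vscale V)"
  shows "fls_nth (fls_vmult V p F) k = Sum_any (\<lambda>i. vscale V (fls_nth p i) (fls_nth F (k - i)))"
proof -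
  interpret vector_space "vscale V" by fact
  show ?thesis
    unfolding fls_vmult_def
  proof (rule nth_Abs_fls_lower_bound, intro allI impI)
    fix k assume k: "k < fls_subdegree p + fls_subdegree F"
    have *: "vscale V (fls_nth p i) (fls_nth F (k - i)) = 0" for i
      using k by (cases "i < fls_subdegree p") auto
    thus "Sum_any (\<lambda>i. vscale V (fls_nth p i) (fls_nth F (k - i))) = 0"
      by (simp only: * Sum_any.neutral)
  qed
qed

lemma fls_nth_vsubst:
  assumes "vector_space (vscale V)" and g: "fls_subdegree g > 0"
  shows "fls_nth (fls_vsubst V F g) k = Sum_any (\<lambda>j. vscale V (fls_nth (g powi j) k) (fls_nth F j))"
proof -
  interpret vector_space "vscale V" by fact
  show ?thesis
    unfolding fls_vsubst_def
  proof (rule nth_Abs_fls_lower_bound, intro allI impI)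
    fix k assume k: "k < fls_subdegree F * fls_subdegree g"
    have *: "vscale V (fls_nth (g powi j) k) (fls_nth F j) = 0" for j
    proof (cases "j < fls_subdegree F")
      case False
      hence "k < j * fls_subdegree g"
        using k g by (smt (verit) mult_right_mono)
      moreover have "fls_subdegree (g powi j) = j * fls_subdegree g"
        using g by (cases "j \<ge> 0")
          (auto simp: power_int_def fls_subdegree_pow fls_inverse_subdegree' power_inverse)
      ultimately show ?thesis by simp
    qed auto
    thus "Sum_any (\<lambda>j. vscale V (fls_nth (g powi j) k) (fls_nth F j)) = 0"
      by (simp only: * Sum_any.neutral)
  qed
qed


section \<open>The fields $X(a,z)$ and $Y[a,t]$\<close>

text \<open>
  \<open>hcomp V v d\<close> is the component of $v$ of weight $d$, so that $z^{L_0}v = \sum_d z^d v_d$.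
\<close>

definition hcomp :: "('v :: ab_group_add) vertex_data \<Rightarrow> 'v \<Rightarrow> nat \<Rightarrow> 'v" where
  "hcomp V v = (THE h. (\<forall>d. h d \<in> wt_space V d) \<and> finite {d. h d \<noteq> 0} \<and> v = Sum_any h)"

text \<open>$X(a,z)b = \sum_d z^{d-1}\, Y(a_d,z)b$; \<^term>\<open>fls_shift n\<close> is multiplication by $z^{-n}$.\<close>

definition Xop :: "('v :: ab_group_add) vertex_data \<Rightarrow> 'v \<Rightarrow> 'v \<Rightarrow> 'v fls" where
  "Xop V a b = Sum_any (\<lambda>d. fls_shift (1 - int d) (vop V (hcomp V a d) b))"

text \<open>$Y[a,t]b = \sum_d e^{2\pi i d t}\, Y(a_d, e^{2\pi i t}-1)b$\<close>

definition Ybr :: "('v :: ab_group_add) vertex_data \<Rightarrow> 'v \<Rightarrow> 'v \<Rightarrow> 'v fls" where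
  "Ybr V a b = Sum_any (\<lambda>d.
     fls_vmult V (fps_to_fls (fps_exp (2 * of_real pi * \<i> * of_nat d)))
       (fls_vsubst V (vop V (hcomp V a d) b)
         (fps_to_fls (fps_exp (2 * of_real pi * \<i>) - 1))))"

text \<open>$a_{[f]}b$\<close>

definition br_prod ::
    "('v :: ab_group_add) vertex_data \<Rightarrow> (complex \<Rightarrow> complex) \<Rightarrow> 'v \<Rightarrow> 'v \<Rightarrow> 'v" where
  "br_prod V f a b = fls_nth (fls_vmult V (laurent_expansion f 0) (Ybr V a b)) (- 1)"


section \<open>Fourier expansions and residues\<close>

definition e2pi :: "complex \<Rightarrow> complex" where
  "e2pi t = exp (2 * of_real pi * \<i> * t)"

definition fourier_expansion ::
    "(complex \<Rightarrow> complex) \<Rightarrow> (int \<Rightarrow> complex) \<Rightarrow> real \<Rightarrow> real \<Rightarrow> bool" where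
  "fourier_expansion f F r R \<longleftrightarrow>
     (\<forall>t. r < norm (e2pi t) \<and> norm (e2pi t) < R \<longrightarrow>
        ((\<lambda>n. F n * e2pi t powi n) has_sum f t) UNIV)"

text \<open>
  $V$ carries no topology. A family in $V$ has sum $s$ if everything takes place in a
  finite-dimensional subspace and the sum converges there; the linear functionals on a
  finite-dimensional space determine its topology, and all of them extend to $V$.
\<close>

definition has_vsum ::
    "('v :: ab_group_add) vertex_data \<Rightarrow> ('i \<Rightarrow> 'v) \<Rightarrow> 'i set \<Rightarrow> 'v \<Rightarrow> bool" where
  "has_vsum V g I s \<longleftrightarrow>
     (\<exists>B. finite B \<and> g ` I \<subseteq> module.span (vscale V) B \<and> s \<in> module.span (vscale V) B) \<and>
     (\<forall>\<phi>. Vector_Spaces.linear (vscale V) (*) \<phi> \<longrightarrow> ((\<lambda>i. \<phi> (g i)) has_sum \<phi> s) I)"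

text \<open>
  For $G(z,w) = \sum_{i,j} G_{ij} z^i w^j$ and $F(z) = \sum_n F_n z^n$, the coefficient of
  $z^{-1}w^m$ in $F(z/w)\,G(z,w)$ is $\sum_n F_n G_{-1-n,\,m+n}$. \<open>res_ratio V F G R\<close> says
  that all these sums converge and that $\mathrm{res}_z F(z/w)\,G(z,w) = R(w) \in V((w))$.
\<close>

definition res_ratio ::
    "('v :: ab_group_add) vertex_data \<Rightarrow> (int \<Rightarrow> complex) \<Rightarrow> (int \<Rightarrow> int \<Rightarrow> 'v)
      \<Rightarrow> 'v fls \<Rightarrow> bool" where
  "res_ratio V F G R \<longleftrightarrow>
     (\<forall>m. has_vsum V (\<lambda>n. vscale V (F n) (G (- 1 - n) (m + n))) UNIV (fls_nth R m))"

text \<open>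
  The coefficients of $z^iw^j$ in $X(a,z)X(b,w)c$ and in $X(b,w)X(a,z)c$; in both $z$ belongs
  to $a$ and $w$ to $b$.
\<close>

definition XaXb ::
    "('v :: ab_group_add) vertex_data \<Rightarrow> 'v \<Rightarrow> 'v \<Rightarrow> 'v \<Rightarrow> int \<Rightarrow> int \<Rightarrow> 'v" where
  "XaXb V a b c i j = fls_nth (Xop V a (fls_nth (Xop V b c) j)) i"

definition XbXa ::
    "('v :: ab_group_add) vertex_data \<Rightarrow> 'v \<Rightarrow> 'v \<Rightarrow> 'v \<Rightarrow> int \<Rightarrow> int \<Rightarrow> 'v" where
  "XbXa V a b c i j = fls_nth (Xop V b (fls_nth (Xop V a c) i)) j"

text \<open>$\mathrm{Hom}(V, V((w)))$\<close>

definition hom_laurent ::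
    "('v :: ab_group_add) vertex_data \<Rightarrow> ('v \<Rightarrow> 'v fls) set" where
  "hom_laurent V =
     {R. \<forall>m. Vector_Spaces.linear (vscale V) (vscale V) (\<lambda>c. fls_nth (R c) m)}"

end

theory Submission
  imports Defs
begin

text \<open>
  Let $a$, $b$ be homogeneous of weights $p$, $r$, fix a vector $c$ and an exponent $m$, and put
  \[ g(n) = a_{(p-1+n)}\,b_{(r-2-m-n)}\,c, \qquad h(n) = b_{(r-2-m-n)}\,a_{(p-1+n)}\,c, \qquad
     u_j = (a_{(j)}b)_{(p+r-3-m-j)}\,c . \]
  The coefficient of $w^m$ in the difference of the two residues is
  $\sum_n F^-_n g(n) - \sum_n F^+_n h(n)$, and that in $2\pi i\,X(a_{[f]}b,w)c$ is
  $\sum_j \rho_j(f)\,u_j$ with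
  $\rho_j(f) = 2\pi i\,\mathrm{res}_t\, f(t)\,e^{2\pi ipt}(e^{2\pi it}-1)^{-j-1}$. One thinks of $g$
  and $h$ as the expansions of one rational function of $x = z/w$ outside and inside the unit circle,
  and of the claim as the residue theorem at $x = 1$. Both sides are linear in $f$, which permits an
  argument with two kinds of $f$ in which the rational function does not occur.

  If $f = (x-1)^N$ with $x = e^{2\pi it}$ and $N$ any integer, then the Fourier coefficients are those
  of the two binomial series, and $\rho_j(f) = \binom{p-1}{j-N}$ for $j \ge N$. The claim is then an
  instance of the Borcherds identity; all sums are finite
  (\<open>residue_exp_powi\<close>, \<open>bracket_pairing_power\<close>).

  If $f$ is regular at $0$, then it is analytic in a strip around the real axis, and moving a horizontal
  line of integration across the axis gives $F^+ = F^- =: F$ (\<open>fourier_coefficients_agree\<close>). These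
  coefficients decay exponentially in both directions, while the commutator formula
  $g(n) - h(n) = \sum_{j\ge0} \binom{p-1+n}{j} u_j$, together with $g(n) = 0$ for $n \ll 0$ and
  $h(n) = 0$ for $n \gg 0$, shows that $g$ and $h$ grow polynomially in one direction and vanish in
  the other. So both sums converge (\<open>regular_kernel_vsums\<close>), and their difference is
  $\sum_j \bigl(\sum_n F_n \binom{p-1+n}{j}\bigr) u_j$. The inner sum is $\rho_j(f)$, because
  $\binom{p-1+n}{j} = \rho_j(e^{2\pi int})$, because $\rho_j$ depends only on finitely many Taylor
  coefficients of a regular function, and because the Fourier series may be differentiated term by
  term (\<open>fourier_taylor\<close>, \<open>regular_part_has_sum\<close>).

  Since $x - 1$ is a local coordinate at $t = 0$, every admissible $f$ is a regular function plus a
  combination of negative powers of $x - 1$ (\<open>fourier_decomposition\<close>). The result extends to arbitrary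
  $a$ and $b$ by bilinearity, and both residues are linear in $c$ because convergent sums in $V$ have
  only one value.
\<close>

section \<open>Formal residues of exponentials\<close>

text \<open>
  Expansions at $t = 0$: \<open>exp_fls l\<close> is that of $x^l$ and \<open>coord_fls\<close> that of the
  coordinate $x - 1$, where $x = e^{2\pi it}$.
\<close>
definition exp_fls :: "int \<Rightarrow> complex fls" where
  "exp_fls l = fps_to_fls (fps_exp (2 * of_real pi * \<i> * of_int l))"

definition coord_fls :: "complex fls" where
  "coord_fls = fps_to_fls (fps_exp (2 * of_real pi * \<i>) - 1)"

lemma exp_fls_add: "exp_fls (k + l) = exp_fls k * exp_fls l"
  by (simp add: exp_fls_def fps_exp_add_mult fls_times_fps_to_fls algebra_simps)

lemma coord_fls_eq: "coord_fls = exp_fls 1 - 1"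
  by (simp add: coord_fls_def exp_fls_def)

lemma subdegree_coord_fls [simp]: "fls_subdegree coord_fls = 1"
proof -
  have "subdegree (fps_exp (2 * of_real pi * \<i>) - 1 :: complex fps) = 1"
    by (rule subdegreeI) auto
  thus ?thesis unfolding coord_fls_def by (simp only: fls_subdegree_fls_to_fps)
qed

lemma coord_fls_nonzero [simp]: "coord_fls \<noteq> 0"
  using subdegree_coord_fls by force

lemma subdegree_exp_fls [simp]: "fls_subdegree (exp_fls l) = 0"
proof -
  have "subdegree (fps_exp (2 * of_real pi * \<i> * of_int l) :: complex fps) = 0"
    by (rule subdegreeI) auto
  thus ?thesis by (simp add: exp_fls_def fls_subdegree_fls_to_fps)
qed

lemma exp_fls_nonzero [simp]: "exp_fls l \<noteq> 0"
  by (simp add: exp_fls_def)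

lemma subdegree_coord_fls_powi [simp]: "fls_subdegree (coord_fls powi N) = N"
proof (cases "N \<ge> 0")
  case True
  thus ?thesis by (simp add: power_int_def fls_subdegree_pow subdegree_coord_fls)
next
  case False
  thus ?thesis
    by (simp add: power_int_def fls_subdegree_pow subdegree_coord_fls fls_inverse_subdegree' power_inverse)
qed

lemma deriv_coord_fls: "fls_deriv coord_fls = fls_const (2 * of_real pi * \<i>) * exp_fls 1"
proof -
  have "fps_deriv (fps_exp (2 * of_real pi * \<i>) - 1 :: complex fps) =
    fps_const (2 * of_real pi * \<i>) * fps_exp (2 * of_real pi * \<i>)" by simp
  thus ?thesis unfolding coord_fls_def fls_deriv_fps_to_fls exp_fls_def
    by (simp only: fls_times_fps_to_fls fps_const_to_fls) simp
qed

text \<open>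
  For $k > 0$ the series is a multiple of the derivative of $(x-1)^{-k}$, since $dx/dt = 2\pi i\,x$. For
  $k = 0$ it is a multiple of the logarithmic derivative of $x - 1$, whose residue is the order of the
  zero.
\<close>
lemma residue_exp_base:
  "2 * of_real pi * \<i> * fls_residue (exp_fls 1 * inverse coord_fls ^ Suc k) = (if k = 0 then 1 else 0)"
proof (cases k)
  case 0
  have "fls_residue (fls_deriv coord_fls * inverse coord_fls) = 1"
    by (subst fls_residue_deriv_times_inverse_eq_subdegree) (simp_all add: subdegree_coord_fls)
  hence "fls_residue (fls_const (2 * of_real pi * \<i>) * (exp_fls 1 * inverse coord_fls)) = 1"
    by (simp only: deriv_coord_fls mult.assoc)
  thus ?thesis using 0 by (simp del: fls_const_mult_const)
next
  case (Suc k')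
  define h where "h = inverse coord_fls"
  have hg: "h * coord_fls = 1" by (simp add: h_def)
  have "fls_deriv h * coord_fls + h * fls_deriv coord_fls = fls_deriv (h * coord_fls)" 
    by (simp only: fls_deriv_mult) (simp add: algebra_simps)
  also have "\<dots> = 0" by (simp add: hg)
  finally have "h * (fls_deriv h * coord_fls + h * fls_deriv coord_fls) = 0" by simp
  hence "fls_deriv h * (h * coord_fls) + h ^ 2 * fls_deriv coord_fls = 0" 
    by (simp add: algebra_simps power2_eq_square)
  hence dh: "fls_deriv h = - (h ^ 2 * fls_deriv coord_fls)"
    by (simp add: hg add_eq_0_iff)
  have "fls_deriv (h ^ k) = of_nat k * h ^ k' * fls_deriv h"
    by (subst fls_deriv_power) (simp add: Suc del: power_Suc)
  also have "\<dots> = fls_const (- of_nat k * (2 * of_real pi * \<i>)) * (exp_fls 1 * h ^ Suc k)"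
  proof -
    have "of_nat k = fls_const (of_nat k :: complex)" by (simp add: fls_of_nat)
    thus ?thesis
      by (simp only: dh deriv_coord_fls fls_const_mult_const[symmetric] fls_const_uminus)
         (simp add: Suc power2_eq_square algebra_simps)
  qed
  finally have "fls_residue (fls_const (- of_nat k * (2 * of_real pi * \<i>)) * (exp_fls 1 * h ^ Suc k)) = 0"
    by (metis fls_residue_deriv)
  hence "(- of_nat k * (2 * of_real pi * \<i>)) * fls_residue (exp_fls 1 * h ^ Suc k) = 0"
    by (simp only: fls_residue_fls_const_times)
  moreover have "(of_nat k :: complex) \<noteq> 0" using Suc by (simp only: of_nat_eq_0_iff)
  ultimately have "fls_residue (exp_fls 1 * h ^ Suc k) = 0" by simp
  thus ?thesis using Suc by (simp only: h_def) simp
qed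

text \<open>
  Multiplication by $x = (x-1) + 1$. This is the recursion of Pascal's triangle, so that
  \<open>residue_exp_base\<close> determines all the residues.
\<close>
lemma residue_exp_step:
  "fls_residue (exp_fls (l + 1) * inverse coord_fls ^ Suc k) =
     fls_residue (exp_fls l * inverse coord_fls ^ Suc k) + (if k = 0 then 0 else fls_residue (exp_fls l * inverse coord_fls ^ k))"
proof -
  have "exp_fls (l + 1) * inverse coord_fls ^ Suc k = exp_fls l * inverse coord_fls ^ Suc k + exp_fls l * inverse coord_fls ^ k * (inverse coord_fls * coord_fls)"
    by (simp only: exp_fls_add) (simp add: coord_fls_eq algebra_simps del: left_inverse right_inverse)
  hence *: "exp_fls (l + 1) * inverse coord_fls ^ Suc k = exp_fls l * inverse coord_fls ^ Suc k + exp_fls l * inverse coord_fls ^ k"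
    by simp
  have "fls_residue (exp_fls l) = 0"
    by (rule fls_residue_power_series) (simp add: subdegree_exp_fls)
  with * show ?thesis by (cases k) (simp_all only: fls_residue_add, auto)
qed

lemma residue_exp:
  "2 * of_real pi * \<i> * fls_residue (exp_fls l * inverse coord_fls ^ Suc k) = of_int (l - 1) gchoose k"
proof (induction k arbitrary: l)
  case 0
  show ?case
    by (induction l rule: int_induct[where k = 1])
       (use residue_exp_base[of 0] residue_exp_step[of _ 0] residue_exp_step[of "_ - 1" 0] in auto)
next
  case (Suc k)
  have st: "2 * of_real pi * \<i> * fls_residue (exp_fls (l + 1) * inverse coord_fls ^ Suc (Suc k)) =
     2 * of_real pi * \<i> * fls_residue (exp_fls l * inverse coord_fls ^ Suc (Suc k)) + (of_int (l - 1) gchoose k)" for l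
    by (subst residue_exp_step) (simp only: Suc.IH[symmetric] ring_distribs, simp)
  have pas: "(of_int l gchoose Suc k :: complex) = (of_int (l - 1) gchoose Suc k) + (of_int (l - 1) gchoose k)" for l
    using gbinomial_Suc_Suc[of "of_int (l - 1) :: complex" k] by simp
  show ?case
  proof (induction l rule: int_induct[where k = 1])
    case base
    show ?case using residue_exp_base[of "Suc k"] by simp
  next
    case (step1 i)
    thus ?case using st[of i] pas[of i] by simp
  next
    case (step2 i)
    have "(of_int (i - 1) gchoose Suc k :: complex) = (of_int (i - 2) gchoose Suc k) + (of_int (i - 2) gchoose k)"
      using pas[of "i - 1"] by simp
    thus ?case using st[of "i - 1"] step2 by simp
  qed
qed

lemma residue_exp_powi:
  "2 * of_real pi * \<i> * fls_nth (exp_fls l * coord_fls powi N) (- 1) =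
     (if N < 0 then of_int (l - 1) gchoose nat (- N - 1) else 0)"
proof (cases "N < 0")
  case True
  define k where "k = nat (- N - 1)"
  have "coord_fls powi N = inverse coord_fls ^ Suc k" 
    using True by (simp add: power_int_def k_def Suc_nat_eq_nat_zadd1)
  thus ?thesis using residue_exp[of l k] True by (simp add: k_def)
next
  case False
  hence "fls_subdegree (exp_fls l * coord_fls powi N) \<ge> 0"
    by (subst fls_subdegree_mult) (simp_all add: power_int_eq_0_iff del: fls_subdegree_power_int)
  thus ?thesis using False fls_residue_power_series[of "exp_fls l * coord_fls powi N"] by simp
qed

text \<open>
  $(x-1)^{-k}$ has a pole of exact order $k$, so that the polar terms can be cleared one at a time,
  starting with the most negative exponent.
\<close>
lemma principal_part_coord_fls:
  assumes "fls_subdegree F \<ge> - int P"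
  shows "\<exists>c. fls_subdegree (F - (\<Sum>k=1..P. fls_const (c k) * coord_fls powi (- int k))) \<ge> 0"
  using assms
proof (induction P arbitrary: F)
  case 0
  thus ?case by simp
next
  case (Suc P)
  define n where "n = - int (Suc P)"
  define d where "d = fls_nth F n / fls_nth (coord_fls powi n) n"
  define F' where "F' = F - fls_const d * coord_fls powi n"
  have nz: "fls_nth (coord_fls powi n) n \<noteq> 0"
    using nth_fls_subdegree_nonzero[of "coord_fls powi n"] by simp
  have "fls_nth F' m = 0" if "m < - int P" for m
  proof (cases "m = n")
    case True
    thus ?thesis using nz by (simp add: F'_def d_def)
  next
    case False
    hence "m < n" using that by (simp add: n_def)
    moreover have "fls_nth F m = 0" using \<open>m < n\<close> Suc.prems by (simp add: n_def)
    moreover have "fls_nth (coord_fls powi n) m = 0" using \<open>m < n\<close> by (simp add: subdegree_coord_fls_powi)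
    ultimately show ?thesis by (simp add: F'_def)
  qed
  hence "fls_subdegree F' \<ge> - int P"
    by (cases "F' = 0") (auto intro: fls_subdegree_geI)
  from Suc.IH[OF this] obtain c where
    c: "fls_subdegree (F' - (\<Sum>k=1..P. fls_const (c k) * coord_fls powi (- int k))) \<ge> 0" by blast
  have "(\<Sum>k=1..P. fls_const ((c(Suc P := d)) k) * coord_fls powi (- int k)) =
        (\<Sum>k=1..P. fls_const (c k) * coord_fls powi (- int k))"
    by (intro sum.cong) auto
  hence "F - (\<Sum>k=1..Suc P. fls_const ((c(Suc P := d)) k) * coord_fls powi (- int k)) =
     F' - (\<Sum>k=1..P. fls_const (c k) * coord_fls powi (- int k))"
    by (simp add: F'_def n_def algebra_simps)
  with c show ?case by metis
qed

section \<open>Fourier coefficients of functions regular at the origin\<close>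

lemma e2pi_powi: "e2pi t powi n = e2pi (of_int n * t)"
  unfolding e2pi_def by (subst exp_power_int) (simp add: algebra_simps)

lemma e2pi_nonzero [simp]: "e2pi t \<noteq> 0"
  by (simp add: e2pi_def)

lemma norm_e2pi: "norm (e2pi t) = exp (- 2 * pi * Im t)"
  by (simp add: e2pi_def)

lemma e2pi_add_int: "e2pi (t + of_int n) = e2pi t"
proof -
  have "exp (2 * of_real pi * \<i> * of_int n) = 1"
    using exp_integer_2pi[of "of_int n"] by (simp add: algebra_simps)
  thus ?thesis by (simp add: e2pi_def ring_distribs exp_add)
qed

lemma e2pi_eq_1_iff: "e2pi t = 1 \<longleftrightarrow> t \<in> \<int>"
proof
  assume "e2pi t = 1"
  then obtain n :: int where n: "2 * of_real pi * \<i> * t = of_real (of_int (2 * n) * pi) * \<i>"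
    unfolding e2pi_def exp_eq_1 by (auto simp: complex_eq_iff)
  hence "t = of_int n" by (auto simp: complex_eq_iff)
  thus "t \<in> \<int>" by simp
next
  assume "t \<in> \<int>"
  then obtain n where "t = of_int n" by (auto elim: Ints_cases)
  thus "e2pi t = 1" using e2pi_add_int[of 0 n] by (simp add: e2pi_def)
qed

lemma e2pi_deriv [derivative_intros]:
  assumes "(f has_field_derivative f') (at x within A)"
  shows "((\<lambda>x. e2pi (f x)) has_field_derivative (2 * of_real pi * \<i> * e2pi (f x) * f')) (at x within A)"
  unfolding e2pi_def by (rule derivative_eq_intros assms refl | simp)+

lemma e2pi_holo [holomorphic_intros]:
  "f holomorphic_on A \<Longrightarrow> (\<lambda>x. e2pi (f x)) holomorphic_on A"
  unfolding e2pi_def by (intro holomorphic_intros)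

lemma contour_integral_e2pi:
  fixes y :: real
  defines "\<gamma> \<equiv> linepath (Complex (- 1/2) y) (Complex (1/2) y)"
  shows "((\<lambda>t. e2pi t powi n) has_contour_integral (if n = 0 then 1 else 0)) \<gamma>"
proof (cases "n = 0")
  case True
  have "((\<lambda>t. 1) has_contour_integral 1 * (Complex (1/2) y - Complex (- 1/2) y)) \<gamma>"
    unfolding \<gamma>_def by (rule has_contour_integral_const_linepath)
  moreover have "Complex (1/2) y - Complex (- 1/2) y = 1" by (simp add: complex_eq_iff)
  ultimately show ?thesis using True by simp
next
  case False
  define G where "G = (\<lambda>t. e2pi (of_int n * t) / (2 * of_real pi * \<i> * of_int n))"
  have "(G has_field_derivative e2pi t powi n) (at t within UNIV)" for t
    unfolding G_def e2pi_powi
    by (rule derivative_eq_intros refl | simp add: False)+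
  hence "((\<lambda>t. e2pi t powi n) has_contour_integral (G (pathfinish \<gamma>) - G (pathstart \<gamma>))) \<gamma>"
    by (intro contour_integral_primitive[where S = UNIV]) (auto simp: \<gamma>_def)
  moreover have "of_int n * pathfinish \<gamma> = of_int n * pathstart \<gamma> + of_int n"
    by (simp add: \<gamma>_def complex_eq_iff algebra_simps)
  hence "G (pathfinish \<gamma>) = G (pathstart \<gamma>)" by (simp add: G_def e2pi_add_int)
  ultimately show ?thesis using False by simp
qed

text \<open>
  The norm of $e^{2\pi it}$ is constant on a horizontal line, so that the series converges uniformly
  there and may be integrated term by term.
\<close>
lemma fourier_coefficient:
  fixes y :: real
  defines "\<gamma> \<equiv> linepath (Complex (- 1/2) y) (Complex (1/2) y)"
  assumes sum: "\<And>t. Im t = y \<Longrightarrow> ((\<lambda>n. F n * e2pi t powi n) has_sum h t) UNIV"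
  shows "contour_integral \<gamma> (\<lambda>t. h t * e2pi t powi (- m)) = F m"
proof -
  define t0 where "t0 = Complex 0 y"
  have im: "Im t = y" if "t \<in> path_image \<gamma>" for t
    using that by (auto simp: \<gamma>_def closed_segment_same_Im)
  have nrm: "norm (e2pi t) = norm (e2pi t0)" if "Im t = y" for t
    using that by (simp add: norm_e2pi t0_def)
  have pw: "e2pi t powi n * e2pi t powi (- m) = e2pi t powi (n - m)" for t n
    by (simp add: power_int_diff power_int_minus field_simps)
  have hs: "((\<lambda>n. F n * e2pi t powi (n - m)) has_sum (h t * e2pi t powi (- m))) UNIV"
    if "Im t = y" for t
    using has_sum_cmult_left[OF sum[OF that], of "e2pi t powi (- m)"] by (simp add: mult.assoc pw)
  have "(\<lambda>n. F n * e2pi t0 powi (n - m)) summable_on UNIV"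
    using hs[of t0] by (auto simp: t0_def summable_on_def)
  hence summ: "(\<lambda>n. norm (F n * e2pi t0 powi (n - m))) summable_on UNIV"
    by (simp only: summable_on_iff_abs_summable_on_complex)
  have ul: "uniform_limit (path_image \<gamma>) (\<lambda>X t. \<Sum>n\<in>X. F n * e2pi t powi (n - m))
           (\<lambda>t. h t * e2pi t powi (- m)) (finite_subsets_at_top UNIV)"
    by (rule Weierstrass_m_test_general'[OF _ _ summ])
       (use im hs nrm in \<open>auto simp: norm_mult norm_power_int\<close>)
  have fin: "((\<lambda>t. \<Sum>n\<in>X. F n * e2pi t powi (n - m)) has_contour_integral
               (\<Sum>n\<in>X. F n * (if n - m = 0 then 1 else 0))) \<gamma>" if "finite X" for X
    unfolding \<gamma>_def
    by (intro has_contour_integral_sum has_contour_integral_lmul contour_integral_e2pi that)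
  have ev: "eventually (\<lambda>X. finite X \<and> m \<in> X) (finite_subsets_at_top (UNIV :: int set))"
    unfolding eventually_finite_subsets_at_top by (rule exI[of _ "{m}"]) auto
  have "((\<lambda>X. contour_integral \<gamma> (\<lambda>t. \<Sum>n\<in>X. F n * e2pi t powi (n - m))) \<longlongrightarrow>
          contour_integral \<gamma> (\<lambda>t. h t * e2pi t powi (- m))) (finite_subsets_at_top UNIV)"
  proof (rule contour_integral_uniform_limit(2)[OF _ ul])
    show "\<forall>\<^sub>F X in finite_subsets_at_top UNIV. (\<lambda>t. \<Sum>n\<in>X. F n * e2pi t powi (n - m)) contour_integrable_on \<gamma>"
      using fin by (intro eventually_finite_subsets_at_top_weakI) (auto simp: contour_integrable_on_def)
    show "norm (vector_derivative \<gamma> (at t)) \<le> norm (Complex (1/2) y - Complex (- 1/2) y)" for t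
      by (simp add: \<gamma>_def)
  qed (auto simp: \<gamma>_def)
  moreover have "((\<lambda>X. contour_integral \<gamma> (\<lambda>t. \<Sum>n\<in>X. F n * e2pi t powi (n - m))) \<longlongrightarrow> F m) (finite_subsets_at_top UNIV)"
  proof (rule tendsto_eventually, rule eventually_mono[OF ev])
    fix X :: "int set" assume X: "finite X \<and> m \<in> X"
    have "(\<Sum>n\<in>X. F n * (if n - m = 0 then 1 else 0)) = (\<Sum>n\<in>X. if n = m then F n else 0)"
      by (intro sum.cong) auto
    also have "\<dots> = F m" using X by simp
    finally show "contour_integral \<gamma> (\<lambda>t. \<Sum>n\<in>X. F n * e2pi t powi (n - m)) = F m"
      using fin[of X] X by (simp add: contour_integral_unique)
  qed
  ultimately show ?thesis
    by (rule tendsto_unique[rotated]) simp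
qed

text \<open>
  Let $K$ be a primitive of $h(t)\,e^{-2\pi imt}$ on the rectangle. By periodicity,
  $K(\frac12+iy) - K(-\frac12+iy)$ does not depend on $y$. It is the $m$-th coefficient of the upper
  expansion for $y > 0$ and that of the lower one for $y < 0$.
\<close>
lemma fourier_coefficients_agree:
  assumes holo: "h holomorphic_on {t. \<bar>Re t\<bar> < 1 \<and> \<bar>Im t\<bar> < T}" and T: "T > 0"
    and Fp: "\<And>t. 0 < Im t \<Longrightarrow> Im t < T \<Longrightarrow> ((\<lambda>n. Fp n * e2pi t powi n) has_sum h t) UNIV"
    and Fm: "\<And>t. - T < Im t \<Longrightarrow> Im t < 0 \<Longrightarrow> ((\<lambda>n. Fm n * e2pi t powi n) has_sum h t) UNIV"
  shows "Fp = Fm"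
proof
  fix m :: int
  define B where "B = {t. \<bar>Re t\<bar> < 1 \<and> \<bar>Im t\<bar> < T}"
  define k where "k = (\<lambda>t. h t * e2pi t powi (- m))"
  have Beq: "B = box (Complex (-1) (-T)) (Complex 1 T)"
    by (auto simp: B_def in_box_complex_iff)
  have "convex B" "open B" by (auto simp: Beq)
  moreover have "k holomorphic_on B"
    unfolding k_def B_def by (intro holomorphic_intros holo) auto
  ultimately obtain K where K: "\<And>t. t \<in> B \<Longrightarrow> (K has_field_derivative k t) (at t within B)"
    using holomorphic_convex_primitive' by blast
  have K': "(K has_field_derivative k t) (at t)" if "t \<in> B" for t
    using K[OF that] that by (metis Beq at_within_open open_box)
  define D where "D = (\<lambda>y. K (Complex (1/2) y) - K (Complex (- 1/2) y))"
  have line: "closed_segment (Complex (-1/2) y) (Complex (1/2) y) \<subseteq> B" if "\<bar>y\<bar> < T" for y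
    by (rule closed_segment_subset) (use that in \<open>auto simp: B_def Beq intro: convex_box\<close>, simp_all add: Beq B_def[symmetric])
  have int: "contour_integral (linepath (Complex (-1/2) y) (Complex (1/2) y)) k = D y" if "\<bar>y\<bar> < T" for y
    using contour_integral_primitive[of B K k "linepath (Complex (-1/2) y) (Complex (1/2) y)"] K line[OF that]
    by (intro contour_integral_unique) (simp add: D_def)
  have dD: "(D has_vector_derivative (\<i> * (k (Complex (1/2) y) - k (Complex (- 1/2) y)))) (at y)" if "\<bar>y\<bar> < T" for y
  proof -
    have "((\<lambda>y. K (Complex c y)) has_vector_derivative (\<i> * k (Complex c y))) (at y)" if "\<bar>c\<bar> < 1" for c
    proof -
      have "Complex c y \<in> B" using that \<open>\<bar>y\<bar> < T\<close> by (simp add: B_def)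
      hence "(K has_field_derivative k (Complex c y)) (at (Complex c y))" by (rule K')
      moreover have "((\<lambda>y. Complex c y) has_vector_derivative \<i>) (at y)"
        unfolding Complex_eq by (auto intro!: derivative_eq_intros)
      ultimately show ?thesis
        using field_vector_diff_chain_at[of "Complex c" \<i> y K "k (Complex c y)"] by (simp add: o_def)
    qed
    from has_vector_derivative_diff[OF this[of "1/2"] this[of "-1/2"]]
    show ?thesis by (simp add: D_def algebra_simps)
  qed
  \<comment> \<open>Periodicity is inherited from the series; nothing is claimed on the real axis, which is a single exceptional value of \<open>y\<close>.\<close>
  have per: "k (Complex (1/2) y) = k (Complex (- 1/2) y)" if "\<bar>y\<bar> < T" "y \<noteq> 0" for y
  proof -
    have shift: "Complex (1/2) y = Complex (-1/2) y + of_int 1" by (simp add: complex_eq_iff)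
    have e: "e2pi (Complex (1/2) y) = e2pi (Complex (- 1/2) y)"
      unfolding shift by (rule e2pi_add_int)
    have "h (Complex (1/2) y) = h (Complex (- 1/2) y)"
    proof (cases "y > 0")
      case True
      thus ?thesis using Fp[of "Complex (1/2) y"] Fp[of "Complex (- 1/2) y"] that
        by (auto simp: e intro: has_sum_unique)
    next
      case False
      thus ?thesis using Fm[of "Complex (1/2) y"] Fm[of "Complex (- 1/2) y"] that
        by (auto simp: e intro: has_sum_unique)
    qed
    thus ?thesis by (simp add: k_def e)
  qed
  define a where "a = T / 2"
  have a: "0 < a" "a < T" using T by (auto simp: a_def)
  have "D a = D (- a)"
  proof (rule has_derivative_zero_unique_strong_interval[where k = "{0}" and a = "- a" and b = a])
    show "continuous_on {- a..a} D"
      by (intro continuous_at_imp_continuous_on ballI has_vector_derivative_continuous[OF dD])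
         (use a in auto)
    fix x assume x: "x \<in> {- a..a} - {0}"
    hence "(D has_vector_derivative 0) (at x)" using dD[of x] per[of x] a by auto
    thus "(D has_derivative (\<lambda>h. 0)) (at x within {- a..a})"
      by (simp add: has_vector_derivative_def has_derivative_at_withinI)
  qed (use a in auto)
  moreover have "D a = Fp m"
    using int[of a] a fourier_coefficient[of a Fp h m] Fp by (simp add: k_def)
  moreover have "D (- a) = Fm m"
    using int[of "- a"] a fourier_coefficient[of "- a" Fm h m] Fm by (simp add: k_def)
  ultimately show "Fp m = Fm m" by simp
qed

lemma higher_deriv_sum_e2pi:
  "(deriv ^^ k) (\<lambda>t. \<Sum>n\<in>X. F n * e2pi t powi n) = 
     (\<lambda>t. \<Sum>n\<in>X. F n * (2 * of_real pi * \<i> * of_int n) ^ k * e2pi t powi n)"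
proof (induction k)
  case (Suc k)
  have "deriv (\<lambda>t. \<Sum>n\<in>X. F n * (2 * of_real pi * \<i> * of_int n) ^ k * e2pi t powi n) t =
    (\<Sum>n\<in>X. F n * (2 * of_real pi * \<i> * of_int n) ^ Suc k * e2pi t powi n)" for t
    unfolding e2pi_powi
    by (rule DERIV_imp_deriv) (rule derivative_eq_intros sum.cong refl | simp)+
  thus ?case by (simp add: Suc)
qed simp

text \<open>
  Absolute convergence on the lines $\mathrm{Im}\,t = \pm r$ dominates the series on the disc of
  radius $r$, real points included. It converges there to a holomorphic function, which equals $h$ in the
  upper half of the disc and hence everywhere, and it may be differentiated term by term.
\<close>
lemma fourier_taylor:
  assumes holo: "h holomorphic_on {t. \<bar>Re t\<bar> < 1 \<and> \<bar>Im t\<bar> < T}" and T: "T > 0"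
    and F: "\<And>t. Im t \<noteq> 0 \<Longrightarrow> \<bar>Im t\<bar> < T \<Longrightarrow> ((\<lambda>n. F n * e2pi t powi n) has_sum h t) UNIV"
  shows "((\<lambda>n. F n * (2 * of_real pi * \<i> * of_int n) ^ k) has_sum (deriv ^^ k) h 0) UNIV"
proof -
  define r where "r = min (1 / 2) (T / 2)"
  have r: "0 < r" "r < 1" "r < T" using T by (auto simp: r_def)
  define M where "M = (\<lambda>n. norm (F n * e2pi (Complex 0 r) powi n) + norm (F n * e2pi (Complex 0 (- r)) powi n))"
  have "(\<lambda>n. norm (F n * e2pi (Complex 0 y) powi n)) summable_on UNIV" if "y = r \<or> y = - r" for y
    using F[of "Complex 0 y"] that r unfolding summable_on_iff_abs_summable_on_complex[symmetric]
    by (auto simp: summable_on_def)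
  hence M: "M summable_on UNIV" unfolding M_def by (intro summable_on_add) auto
  have bound: "norm (F n * e2pi t powi n) \<le> M n" if "t \<in> cball 0 r" for n t
  proof -
    have im: "\<bar>Im t\<bar> \<le> r" using that abs_Im_le_cmod[of t] by simp
    have e: "norm (e2pi t powi n) = exp (- 2 * pi * (of_int n * Im t))" for t
      by (simp add: e2pi_powi norm_e2pi)
    have "\<bar>of_int n * Im t\<bar> \<le> \<bar>of_int n * r\<bar>"
      using im r by (auto simp: abs_mult intro: mult_left_mono)
    hence "- (of_int n * Im t) \<le> - (of_int n * r) \<or> - (of_int n * Im t) \<le> of_int n * r" by linarith
    hence "- 2 * pi * (of_int n * Im t) \<le> - 2 * pi * (of_int n * r) \<or>
           - 2 * pi * (of_int n * Im t) \<le> - 2 * pi * (of_int n * (- r))"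
      using pi_gt_zero by (smt (verit) mult_le_cancel_left_pos mult_minus_left mult_minus_right mult_left_mono)
    hence "norm (e2pi t powi n) \<le> norm (e2pi (Complex 0 r) powi n) + norm (e2pi (Complex 0 (- r)) powi n)"
      unfolding e by (smt (verit) complex.sel exp_ge_zero exp_le_cancel_iff)
    thus ?thesis unfolding M_def norm_mult
      by (metis distrib_left mult_left_mono norm_ge_zero)
  qed
  define G where "G = (\<lambda>t. \<Sum>\<^sub>\<infinity>n. F n * e2pi t powi n)"
  have ulc: "uniform_limit (cball 0 r) (\<lambda>X t. \<Sum>n\<in>X. F n * e2pi t powi n) G (finite_subsets_at_top UNIV)"
    unfolding G_def by (rule Weierstrass_m_test_general[OF bound M])
  hence ul: "uniform_limit (ball 0 r) (\<lambda>X t. \<Sum>n\<in>X. F n * e2pi t powi n) G (finite_subsets_at_top UNIV)"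
    by (rule uniform_limit_on_subset) auto
  have fholo: "(\<lambda>t. \<Sum>n\<in>X. F n * e2pi t powi n) holomorphic_on A" for X A
    by (intro holomorphic_intros) auto
  have Gholo: "G holomorphic_on ball 0 r"
    by (rule holomorphic_uniform_limit[OF _ ulc])
       (auto intro!: always_eventually holomorphic_on_imp_continuous_on fholo)
  have sub: "ball 0 r \<subseteq> {t. \<bar>Re t\<bar> < 1 \<and> \<bar>Im t\<bar> < T}"
  proof
    fix t :: complex assume "t \<in> ball 0 r"
    thus "t \<in> {t. \<bar>Re t\<bar> < 1 \<and> \<bar>Im t\<bar> < T}"
      using r abs_Re_le_cmod[of t] abs_Im_le_cmod[of t] by simp
  qed
  have eq: "h t = G t" if "t \<in> ball 0 r" for t
  proof (rule analytic_continuation_open[of "ball 0 r \<inter> {t. Im t > 0}" "ball 0 r" h G])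
    show "open (ball 0 r \<inter> {t. Im t > 0})" by (intro open_Int open_halfspace_Im_gt) auto
    have "Complex 0 (r / 2) \<in> ball 0 r \<inter> {t. Im t > 0}" using r by (simp add: cmod_def)
    thus "ball 0 r \<inter> {t. Im t > 0} \<noteq> {}" by blast
    show "h z = G z" if "z \<in> ball 0 r \<inter> {t. Im t > 0}" for z
      using F[of z] that sub unfolding G_def by (auto simp: has_sum_iff)
  qed (use that Gholo holomorphic_on_subset[OF holo sub] in auto)
  have "((\<lambda>X. (deriv ^^ k) (\<lambda>t. \<Sum>n\<in>X. F n * e2pi t powi n) 0) \<longlongrightarrow> (deriv ^^ k) G 0) (finite_subsets_at_top UNIV)"
    by (rule higher_deriv_complex_uniform_limit[OF ul]) (use fholo r in auto)
  also have "(deriv ^^ k) G 0 = (deriv ^^ k) h 0"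
    by (intro higher_deriv_cong_ev eventually_nhds_in_open[THEN eventually_mono, of "ball 0 r"]) (use eq r in auto)
  finally show ?thesis
    by (simp add: higher_deriv_sum_e2pi has_sum_def) (simp add: e2pi_def)
qed

section \<open>Splitting off the principal part\<close>

text \<open>
  The coefficients of $(x-1)^N$, for any integer $N$, expanded in powers of $x$ for $|x| < 1$
  (\<open>inner_coeff\<close>) and in powers of $x^{-1}$ for $|x| > 1$ (\<open>outer_coeff\<close>).
\<close>
definition inner_coeff :: "int \<Rightarrow> int \<Rightarrow> complex" where
  "inner_coeff N n = (if n \<ge> 0 then (- 1) ^ nat n * (of_int N gchoose nat n) * (- 1) powi N else 0)"

definition outer_coeff :: "int \<Rightarrow> int \<Rightarrow> complex" where
  "outer_coeff N n = (if n \<le> N then (- 1) ^ nat (N - n) * (of_int N gchoose nat (N - n)) else 0)"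

lemma has_sum_sum:
  fixes g :: "'i \<Rightarrow> 'a \<Rightarrow> complex"
  assumes "\<And>i. i \<in> I \<Longrightarrow> (g i has_sum s i) A"
  shows "((\<lambda>x. \<Sum>i\<in>I. g i x) has_sum (\<Sum>i\<in>I. s i)) A"
  using assms by (induction I rule: infinite_finite_induct) (simp_all add: has_sum_add)

lemma has_sum_diff:
  fixes g h :: "'a \<Rightarrow> complex"
  assumes "(g has_sum s) A" "(h has_sum t) A"
  shows "((\<lambda>x. g x - h x) has_sum (s - t)) A"
  using has_sum_add[OF assms(1) has_sum_uminusI[OF assms(2)]] by simp

lemma has_sum_binomial_series:
  fixes z :: complex
  assumes z: "norm z < 1"
  shows "((\<lambda>j. (- 1) ^ j * (of_int N gchoose j) * z ^ j) has_sum (1 - z) powi N) UNIV"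
proof -
  have "1 - z \<noteq> 0" using z by auto
  hence sums: "(\<lambda>j. (of_int N gchoose j) * (- z) ^ j) sums (1 - z) powi N"
    using gen_binomial_complex[of "- z" "of_int N"] z by (simp add: complex_powr_of_int)
  define r where "r = (1 + norm z) / 2"
  have r: "norm z < r" "r < 1" using z by (auto simp: r_def)
  hence "summable (\<lambda>j. (of_int N gchoose j :: complex) * of_real r ^ j)"
    using gen_binomial_complex[of "of_real r" "of_int N"] norm_ge_zero[of z]
    by (auto simp: sums_iff simp del: norm_ge_zero)
  hence "summable (\<lambda>j. norm ((of_int N gchoose j :: complex) * (- z) ^ j))"
    by (rule powser_insidea) (use r norm_ge_zero[of z] in \<open>auto simp del: norm_ge_zero\<close>)
  from norm_summable_imp_has_sum[OF this sums]
  show ?thesis by (simp add: power_minus[of z] mult_ac)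
qed

lemma has_sum_int_embed:
  fixes G :: "int \<Rightarrow> complex"
  assumes "((\<lambda>j. G (e j)) has_sum s) (UNIV :: nat set)" "inj e" "\<And>n. n \<notin> range e \<Longrightarrow> G n = 0"
  shows "(G has_sum s) UNIV"
proof -
  have "(G has_sum s) (range e)"
    by (subst has_sum_reindex[OF assms(2)]) (use assms(1) in \<open>simp add: o_def\<close>)
  thus ?thesis
    by (subst has_sum_cong_neutral[of "range e" UNIV G G]) (use assms(3) in auto)
qed

lemma inner_coeff_has_sum:
  assumes "norm x < 1"  "x \<noteq> 0"
  shows "((\<lambda>n. inner_coeff N n * x powi n) has_sum (x - 1) powi N) UNIV"
proof (rule has_sum_int_embed[where e = int])
  have "((\<lambda>j. (- 1) powi N * ((- 1) ^ j * (of_int N gchoose j) * x ^ j)) has_sum (- 1) powi N * (1 - x) powi N) UNIV"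
    by (intro has_sum_cmult_right has_sum_binomial_series assms)
  also have "(- 1) powi N * (1 - x) powi N = (x - 1) powi N"
    by (simp add: power_int_mult_distrib[symmetric])
  finally show "((\<lambda>j. inner_coeff N (int j) * x powi int j) has_sum (x - 1) powi N) UNIV"
    by (simp add: inner_coeff_def mult_ac)
  show "inner_coeff N n * x powi n = 0" if "n \<notin> range int" for n
    using that by (cases "n \<ge> 0") (auto simp: inner_coeff_def image_iff elim: nonneg_int_cases)
qed auto

lemma outer_coeff_has_sum:
  assumes "norm x > 1"
  shows "((\<lambda>n. outer_coeff N n * x powi n) has_sum (x - 1) powi N) UNIV"
proof (rule has_sum_int_embed[where e = "\<lambda>j. N - int j"])
  have nz: "x \<noteq> 0" using assms by auto
  have "((\<lambda>j. x powi N * ((- 1) ^ j * (of_int N gchoose j) * inverse x ^ j)) has_sum x powi N * (1 - inverse x) powi N) UNIV"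
    by (intro has_sum_cmult_right has_sum_binomial_series)
       (use assms in \<open>simp add: norm_inverse inverse_less_1_iff\<close>)
  also have "x powi N * (1 - inverse x) powi N = (x - 1) powi N"
    using nz by (simp add: power_int_mult_distrib[symmetric] algebra_simps)
  finally show "((\<lambda>j. outer_coeff N (N - int j) * x powi (N - int j)) has_sum (x - 1) powi N) UNIV"
    using nz by (simp add: outer_coeff_def mult_ac power_int_diff field_simps)
  show "outer_coeff N n * x powi n = 0" if "n \<notin> range (\<lambda>j. N - int j)" for n
  proof (cases "n \<le> N")
    case True
    hence "n = N - int (nat (N - n))" by simp
    thus ?thesis using that by blast
  qed (simp add: outer_coeff_def)
qed (auto simp: inj_on_def)

lemma fls_nth_power_series_times:
  fixes A :: "complex fps" and M :: "complex fls"
  assumes M: "fls_subdegree M = - int j - 1"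
  shows "fls_nth (fps_to_fls A * M) (- 1) = (\<Sum>k\<le>j. fps_nth A k * fls_nth M (- 1 - int k))"
proof -
  define d where "d = subdegree A"
  have "fls_nth (fps_to_fls A * M) (- 1) = (\<Sum>i=int d..int j. fls_nth (fps_to_fls A) i * fls_nth M (- 1 - i))"
    by (subst fls_times_nth(2)) (simp add: M d_def fls_subdegree_fls_to_fps)
  also have "\<dots> = (\<Sum>i\<in>int ` {..j}. fls_nth (fps_to_fls A) i * fls_nth M (- 1 - i))"
  proof (rule sum.mono_neutral_left)
    show "{int d..int j} \<subseteq> int ` {..j}"
    proof
      fix i assume "i \<in> {int d..int j}"
      thus "i \<in> int ` {..j}" by (intro image_eqI[of _ _ "nat i"]) auto
    qed
    show "\<forall>i\<in>int ` {..j} - {int d..int j}. fls_nth (fps_to_fls A) i * fls_nth M (- 1 - i) = 0"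
    proof
      fix i assume "i \<in> int ` {..j} - {int d..int j}"
      then obtain k where "i = int k" "k < subdegree A" by (auto simp: d_def)
      thus "fls_nth (fps_to_fls A) i * fls_nth M (- 1 - i) = 0"
        by (simp only: fps_to_fls_nth nth_less_subdegree_zero) simp
    qed
  qed simp
  also have "\<dots> = (\<Sum>k\<le>j. fps_nth A k * fls_nth M (- 1 - int k))"
    by (subst sum.reindex) (simp_all only: inj_on_of_nat o_def, simp)
  finally show ?thesis .
qed

lemma has_laurent_expansion_e2pi_minus_1: "(\<lambda>t. e2pi t - 1) has_laurent_expansion coord_fls"
proof -
  have "(\<lambda>t. exp (2 * of_real pi * \<i> * t) - 1) has_fps_expansion (fps_exp (2 * of_real pi * \<i>) - 1)"
    by (intro fps_expansion_intros)
  thus ?thesis unfolding e2pi_def coord_fls_def by (rule has_laurent_expansion_fps)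
qed

text \<open>
  Removal of a removable singularity at $0$, in a form that keeps track of the expansion.
\<close>
lemma has_laurent_expansion_fill:
  assumes "f has_laurent_expansion L" "fls_subdegree L \<ge> 0"
  shows "(\<lambda>t. if t = 0 then fls_nth L 0 else f t) has_fps_expansion fls_regpart L"
proof -
  define P where "P = fls_regpart L"
  have L: "L = fps_to_fls P" using assms(2) by (simp add: P_def)
  have r: "fps_conv_radius P > 0" and ev: "eventually (\<lambda>z. eval_fls L z = f z) (at 0)"
    using assms(1) by (auto simp: has_laurent_expansion_def L)
  have "eventually (\<lambda>z. z \<in> eball 0 (fps_conv_radius P)) (at (0 :: complex))"
    using r by (intro eventually_at_in_open') (auto simp: zero_ereal_def)
  with ev have "eventually (\<lambda>z. eval_fps P z = f z) (at 0)"
    by eventually_elim (auto simp: L eval_fps_to_fls)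
  hence "eventually (\<lambda>z. z \<noteq> 0 \<longrightarrow> eval_fps P z = f z) (nhds 0)"
    by (simp add: eventually_at_filter)
  hence "eventually (\<lambda>z. eval_fps P z = (if z = 0 then fls_nth L 0 else f z)) (nhds 0)"
    by eventually_elim (auto simp: L eval_fps_at_0)
  thus ?thesis using r unfolding has_fps_expansion_def P_def by (simp add: eq_commute)
qed

text \<open>
  $\binom{p-1+n}{j}$ is $2\pi i$ times the residue of $e^{2\pi int}\,x^p\,(x-1)^{-j-1}$. The residue of
  $P$ times $x^p(x-1)^{-j-1}$ is a linear function of the first $j+1$ coefficients of $P$, each of which
  is the sum over $n$ of $F_n$ times the corresponding coefficient of $e^{2\pi int}$.
\<close>
lemma regular_part_has_sum:
  fixes F :: "int \<Rightarrow> complex"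
  assumes P: "\<And>k. ((\<lambda>n. F n * (2 * of_real pi * \<i> * of_int n) ^ k / fact k) has_sum fps_nth P k) UNIV"
  shows "((\<lambda>n. F n * (of_int (p - 1 + n) gchoose j)) has_sum
           2 * of_real pi * \<i> * fls_nth (fps_to_fls P * exp_fls p * coord_fls powi (- int j - 1)) (- 1)) UNIV"
proof -
  define M where "M = exp_fls p * coord_fls powi (- int j - 1)"
  have M: "fls_subdegree M = - int j - 1"
    unfolding M_def by (subst fls_subdegree_mult) (simp_all add: power_int_eq_0_iff)
  \<comment> \<open>The residue functional, applied to $F_n e^{2\pi int}$.\<close>
  have "2 * of_real pi * \<i> * (\<Sum>k\<le>j. F n * (2 * of_real pi * \<i> * of_int n) ^ k / fact k * fls_nth M (- 1 - int k)) = 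
          F n * (of_int (p - 1 + n) gchoose j)" for n
  proof -
    have "(\<Sum>k\<le>j. (2 * of_real pi * \<i> * of_int n) ^ k / fact k * fls_nth M (- 1 - int k)) = fls_nth (exp_fls n * M) (- 1)"
      unfolding exp_fls_def by (subst fls_nth_power_series_times[OF M]) simp
    also have "exp_fls n * M = exp_fls (p + n) * coord_fls powi (- int j - 1)"
      by (simp add: M_def exp_fls_add mult_ac)
    finally have "2 * of_real pi * \<i> * (\<Sum>k\<le>j. (2 * of_real pi * \<i> * of_int n) ^ k / fact k * fls_nth M (- 1 - int k)) = 
       of_int (p - 1 + n) gchoose j"
      by (simp only: residue_exp_powi) (simp add: algebra_simps)
    moreover have "(\<Sum>k\<le>j. F n * (2 * of_real pi * \<i> * of_int n) ^ k / fact k * fls_nth M (- 1 - int k)) =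
       F n * (\<Sum>k\<le>j. (2 * of_real pi * \<i> * of_int n) ^ k / fact k * fls_nth M (- 1 - int k))"
      unfolding sum_distrib_left by (rule sum.cong) (simp_all only: mult.assoc times_divide_eq_right times_divide_eq_left)
    ultimately show ?thesis by (simp only: mult.left_commute)
  qed
  moreover have "((\<lambda>n. 2 * of_real pi * \<i> * (\<Sum>k\<le>j. F n * (2 * of_real pi * \<i> * of_int n) ^ k / fact k * fls_nth M (- 1 - int k))) has_sum
     2 * of_real pi * \<i> * (\<Sum>k\<le>j. fps_nth P k * fls_nth M (- 1 - int k))) UNIV"
    by (rule has_sum_cmult_right, rule has_sum_sum, rule has_sum_cmult_left, rule P)
  moreover have "fls_nth (fps_to_fls P * exp_fls p * coord_fls powi (- int j - 1)) (- 1) =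
      (\<Sum>k\<le>j. fps_nth P k * fls_nth M (- 1 - int k))"
    unfolding mult.assoc M_def[symmetric] by (rule fls_nth_power_series_times[OF M])
  ultimately show ?thesis by (simp only:)
qed

text \<open>
  The analytic input of the theorem: \<open>L0\<close> is the expansion of the regular part of $f$, and
  \<open>F0\<close> is the common sequence of Fourier coefficients of that part on either side of the real
  axis.
\<close>
lemma fourier_decomposition:
  assumes T: "Im \<tau> > 0"
    and mero: "f meromorphic_on {0}"
    and an: "f analytic_on {t. - Im \<tau> < Im t \<and> Im t < Im \<tau>} - \<int>"
    and Fp: "fourier_expansion f Fp (norm (e2pi \<tau>)) 1"
    and Fm: "fourier_expansion f Fm 1 (inverse (norm (e2pi \<tau>)))"
  obtains P :: nat and c L0 F0 where
    "laurent_expansion f 0 = L0 + (\<Sum>k=1..P. fls_const (c k) * coord_fls powi (- int k))"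
    "fls_subdegree L0 \<ge> 0"
    "\<And>n. Fp n = F0 n + (\<Sum>k=1..P. c k * inner_coeff (- int k) n)"
    "\<And>n. Fm n = F0 n + (\<Sum>k=1..P. c k * outer_coeff (- int k) n)"
    "\<And>p j. ((\<lambda>n. F0 n * (of_int (p - 1 + n) gchoose j)) has_sum
           2 * of_real pi * \<i> * fls_nth (L0 * exp_fls p * coord_fls powi (- int j - 1)) (- 1)) UNIV"
proof -
  define L where "L = laurent_expansion f 0"
  have L: "f has_laurent_expansion L"
    using meromorphic_on_imp_has_laurent_expansion[OF mero, of 0] by (simp add: L_def)
  define P where "P = nat (- fls_subdegree L)"
  have "\<exists>c. fls_subdegree (L - (\<Sum>k=1..P. fls_const (c k) * coord_fls powi (- int k))) \<ge> 0"
    by (rule principal_part_coord_fls) (simp add: P_def)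
  then obtain c where c: "fls_subdegree (L - (\<Sum>k=1..P. fls_const (c k) * coord_fls powi (- int k))) \<ge> 0"
    by blast
  define L0 where "L0 = L - (\<Sum>k=1..P. fls_const (c k) * coord_fls powi (- int k))"
  have L0: "fls_subdegree L0 \<ge> 0" using c unfolding L0_def .
  define f0 where "f0 = (\<lambda>t. f t - (\<Sum>k=1..P. c k * (e2pi t - 1) powi (- int k)))"
  have f0_L0: "f0 has_laurent_expansion L0"
    unfolding f0_def L0_def
    by (intro laurent_expansion_intros L has_laurent_expansion_e2pi_minus_1)
  define h where "h = (\<lambda>t. if t = 0 then fls_nth L0 0 else f0 t)"
  have h_fps: "h has_fps_expansion fls_regpart L0"
    unfolding h_def by (rule has_laurent_expansion_fill[OF f0_L0 L0])
  define B where "B = {t. \<bar>Re t\<bar> < 1 \<and> \<bar>Im t\<bar> < Im \<tau>}"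
  have Beq: "B = box (Complex (-1) (- Im \<tau>)) (Complex 1 (Im \<tau>))"
    by (auto simp: B_def in_box_complex_iff)
  \<comment> \<open>The only integer in the rectangle \<open>B\<close> is $0$.\<close>
  have "h analytic_on {t}" if t: "t \<in> B" for t
  proof (cases "t = 0")
    case True
    show ?thesis unfolding True using h_fps by (rule has_fps_expansion_imp_analytic_0)
  next
    case False
    have "t \<notin> \<int>"
    proof
      assume "t \<in> \<int>"
      then obtain n where n: "t = of_int n" by (auto elim: Ints_cases)
      thus False using t False by (auto simp: B_def)
    qed
    hence "f0 analytic_on {t}"
      unfolding f0_def e2pi_def
      by (intro analytic_intros analytic_on_subset[OF an])
         (use t e2pi_eq_1_iff[of t] in \<open>auto simp: B_def e2pi_def\<close>)
    moreover have "eventually (\<lambda>x. h x = f0 x) (nhds t)"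
      using t1_space_nhds[OF False] by eventually_elim (simp add: h_def)
    ultimately show ?thesis using analytic_at_cong[of h f0 t t] by simp
  qed
  hence "h analytic_on B" using analytic_on_analytic_at by blast
  hence holo: "h holomorphic_on B" by (rule analytic_imp_holomorphic)
  define Fp0 where "Fp0 = (\<lambda>n. Fp n - (\<Sum>k=1..P. c k * inner_coeff (- int k) n))"
  define Fm0 where "Fm0 = (\<lambda>n. Fm n - (\<Sum>k=1..P. c k * outer_coeff (- int k) n))"
  have hp: "((\<lambda>n. Fp0 n * e2pi t powi n) has_sum h t) UNIV" if "0 < Im t" "Im t < Im \<tau>" for t
  proof -
    have "((\<lambda>n. Fp n * e2pi t powi n) has_sum f t) UNIV"
      using Fp that by (simp add: fourier_expansion_def norm_e2pi)
    hence "((\<lambda>n. Fp n * e2pi t powi n - (\<Sum>k=1..P. c k * (inner_coeff (- int k) n * e2pi t powi n))) has_sum f0 t) UNIV"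
      unfolding f0_def using that
      by (intro has_sum_diff has_sum_sum has_sum_cmult_right inner_coeff_has_sum) (auto simp: norm_e2pi)
    moreover have "h t = f0 t" using that by (auto simp: h_def)
    ultimately show ?thesis by (simp add: Fp0_def ring_distribs sum_distrib_right mult.assoc)
  qed
  have hm: "((\<lambda>n. Fm0 n * e2pi t powi n) has_sum h t) UNIV" if "- Im \<tau> < Im t" "Im t < 0" for t
  proof -
    have "((\<lambda>n. Fm n * e2pi t powi n) has_sum f t) UNIV"
    proof -
      have "- (pi * Im t) < pi * Im \<tau>"
        using mult_strict_left_mono[of "- Im t" "Im \<tau>" pi] that by simp
      thus ?thesis
        using Fm that by (simp add: fourier_expansion_def norm_e2pi mult_pos_neg flip: exp_minus)
    qed
    hence "((\<lambda>n. Fm n * e2pi t powi n - (\<Sum>k=1..P. c k * (outer_coeff (- int k) n * e2pi t powi n))) has_sum f0 t) UNIV"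
      unfolding f0_def using that
      by (intro has_sum_diff has_sum_sum has_sum_cmult_right outer_coeff_has_sum) (auto simp: norm_e2pi mult_pos_neg)
    moreover have "h t = f0 t" using that by (auto simp: h_def)
    ultimately show ?thesis by (simp add: Fm0_def ring_distribs sum_distrib_right mult.assoc)
  qed
  have eq: "Fp0 = Fm0"
    by (rule fourier_coefficients_agree[OF holo[unfolded B_def] T hp hm])
  have taylor: "((\<lambda>n. Fp0 n * (2 * of_real pi * \<i> * of_int n) ^ k) has_sum (deriv ^^ k) h 0) UNIV" for k
  proof (rule fourier_taylor[OF holo[unfolded B_def] T])
    fix t assume "Im t \<noteq> 0" "\<bar>Im t\<bar> < Im \<tau>"
    hence "0 < Im t \<and> Im t < Im \<tau> \<or> - Im \<tau> < Im t \<and> Im t < 0" by linarith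
    thus "((\<lambda>n. Fp0 n * e2pi t powi n) has_sum h t) UNIV"
      using hp hm unfolding eq by blast
  qed
  have fps: "((\<lambda>n. Fp0 n * (2 * of_real pi * \<i> * of_int n) ^ k / fact k) has_sum fps_nth (fls_regpart L0) k) UNIV" for k
    unfolding fps_nth_fps_expansion[OF h_fps] by (rule has_sum_divide_const[OF taylor])
  show ?thesis
  proof (rule that[of L0 c P Fp0])
    show "laurent_expansion f 0 = L0 + (\<Sum>k=1..P. fls_const (c k) * coord_fls powi (- int k))"
      by (simp add: L0_def L_def)
    show "fls_subdegree L0 \<ge> 0" by fact
    show "Fp n = Fp0 n + (\<Sum>k=1..P. c k * inner_coeff (- int k) n)" for n by (simp add: Fp0_def)
    show "Fm n = Fp0 n + (\<Sum>k=1..P. c k * outer_coeff (- int k) n)" for n unfolding eq by (simp add: Fm0_def)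
    show "((\<lambda>n. Fp0 n * (of_int (p - 1 + n) gchoose j)) has_sum
           2 * of_real pi * \<i> * fls_nth (L0 * exp_fls p * coord_fls powi (- int j - 1)) (- 1)) UNIV" for p j
      using regular_part_has_sum[OF fps, of p j] by (simp only: fls_regpart_to_fls_trivial[OF L0])
  qed
qed

section \<open>Finite sums\<close>

lemma Sum_any_additive:
  assumes "\<And>x y. f (x + y) = f x + f y" "f 0 = 0" "finite {i. g i \<noteq> 0}"
  shows "f (Sum_any g) = Sum_any (\<lambda>i. f (g i))"
proof -
  have fs: "f (sum g I) = (\<Sum>i\<in>I. f (g i))" for I
    by (induction I rule: infinite_finite_induct) (simp_all add: assms)
  have "Sum_any (\<lambda>i. f (g i)) = (\<Sum>i\<in>{i. g i \<noteq> 0}. f (g i))"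
    by (rule Sum_any.expand_superset) (use assms in \<open>auto simp: assms(2)\<close>)
  thus ?thesis by (simp add: Sum_any.expand_set fs)
qed

lemma Sum_any_reindex:
  assumes "inj e" "\<And>n. n \<notin> range e \<Longrightarrow> G n = 0"
  shows "Sum_any G = Sum_any (\<lambda>j. G (e j))"
proof -
  have "{n. G n \<noteq> 0} = e ` {j. G (e j) \<noteq> 0}" using assms(2) by force
  moreover have "inj_on e {j. G (e j) \<noteq> 0}" using assms(1) by (auto simp: inj_on_def)
  ultimately show ?thesis by (simp add: Sum_any.expand_set sum.reindex)
qed

lemma finite_int_between:
  fixes A :: "int set"
  assumes "\<And>n. n \<in> A \<Longrightarrow> l \<le> n \<and> n \<le> k"
  shows "finite A"
  by (rule finite_subset[of _ "{l..k}"]) (use assms in auto)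

section \<open>Convergent sums of vectors\<close>

context
  fixes V :: "('v :: ab_group_add) vertex_data"
  assumes vs: "vector_space (vscale V)"
begin

interpretation vector_space "vscale V" by (rule vs)

lemma functional_add: "Vector_Spaces.linear (vscale V) (*) \<phi> \<Longrightarrow> \<phi> (x + y) = \<phi> x + (\<phi> y :: complex)"
  by (metis Vector_Spaces.linear_iff)

lemma functional_scale: "Vector_Spaces.linear (vscale V) (*) \<phi> \<Longrightarrow> \<phi> (vscale V c x) = c * (\<phi> x :: complex)"
  by (metis Vector_Spaces.linear_iff)

lemma has_vsum_functional:
  "has_vsum V g I s \<Longrightarrow> Vector_Spaces.linear (vscale V) (*) \<phi> \<Longrightarrow> ((\<lambda>i. \<phi> (g i)) has_sum \<phi> s) I"
  unfolding has_vsum_def by (elim conjE allE impE)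

lemma has_vsum_add:
  assumes "has_vsum V g I s" "has_vsum V h I t"
  shows "has_vsum V (\<lambda>i. g i + h i) I (s + t)"
proof -
  obtain B C where B: "finite B" "g ` I \<subseteq> span B" "s \<in> span B"
    and C: "finite C" "h ` I \<subseteq> span C" "t \<in> span C"
    using assms unfolding has_vsum_def by blast
  have "span B \<subseteq> span (B \<union> C)" "span C \<subseteq> span (B \<union> C)" by (simp_all add: span_mono)
  with B C have "finite (B \<union> C)" "(\<lambda>i. g i + h i) ` I \<subseteq> span (B \<union> C)" "s + t \<in> span (B \<union> C)"
    by (auto intro!: span_add)
  moreover have "((\<lambda>i. \<phi> (g i + h i)) has_sum \<phi> (s + t)) I"
    if "Vector_Spaces.linear (vscale V) (*) \<phi>" for \<phi>
    unfolding functional_add[OF that]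
    by (rule has_sum_add) (rule has_vsum_functional[OF _ that], fact assms)+
  ultimately show ?thesis unfolding has_vsum_def by blast
qed

lemma has_vsum_scale:
  assumes "has_vsum V g I s"
  shows "has_vsum V (\<lambda>i. vscale V c (g i)) I (vscale V c s)"
proof -
  obtain B where B: "finite B" "g ` I \<subseteq> span B" "s \<in> span B"
    using assms unfolding has_vsum_def by blast
  hence "(\<lambda>i. vscale V c (g i)) ` I \<subseteq> span B" "vscale V c s \<in> span B"
    by (auto intro: span_scale)
  moreover have "((\<lambda>i. \<phi> (vscale V c (g i))) has_sum \<phi> (vscale V c s)) I"
    if "Vector_Spaces.linear (vscale V) (*) \<phi>" for \<phi>
    unfolding functional_scale[OF that]
    by (rule has_sum_cmult_right, rule has_vsum_functional[OF assms that])
  ultimately show ?thesis using B(1) unfolding has_vsum_def by blast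
qed

lemma has_vsum_smult:
  assumes "(x has_sum s) I"
  shows "has_vsum V (\<lambda>i. vscale V (x i) u) I (vscale V s u)"
proof -
  have "(\<lambda>i. vscale V (x i) u) ` I \<subseteq> span {u}" "vscale V s u \<in> span {u}"
    by (auto intro: span_scale span_base)
  moreover have "((\<lambda>i. \<phi> (vscale V (x i) u)) has_sum \<phi> (vscale V s u)) I"
    if "Vector_Spaces.linear (vscale V) (*) \<phi>" for \<phi>
    using assms unfolding functional_scale[OF that] by (rule has_sum_cmult_left)
  ultimately show ?thesis unfolding has_vsum_def by (meson finite.intros)
qed

lemma has_vsum_zero: "has_vsum V (\<lambda>i. 0) I 0"
  using has_vsum_smult[OF has_sum_0, of I "\<lambda>_. 0" 0] by simp

lemma has_vsum_sum:
  assumes "\<And>k. k \<in> K \<Longrightarrow> has_vsum V (g k) I (s k)"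
  shows "has_vsum V (\<lambda>i. \<Sum>k\<in>K. g k i) I (\<Sum>k\<in>K. s k)"
  using assms by (induction K rule: infinite_finite_induct) (simp_all add: has_vsum_add has_vsum_zero)

text \<open>
  The sum is written as a finite combination of the vectors in its range with indicator functions as
  coefficients, which reduces it to the scalar case.
\<close>
lemma has_vsum_finite_support:
  assumes "finite {i. g i \<noteq> 0}"
  shows "has_vsum V g UNIV (Sum_any g)"
proof -
  define K where "K = {i. g i \<noteq> 0}"
  have "has_vsum V (\<lambda>i. \<Sum>k\<in>K. vscale V (if i = k then 1 else 0) (g k)) UNIV (\<Sum>k\<in>K. vscale V 1 (g k))"
  proof (rule has_vsum_sum, rule has_vsum_smult)
    show "((\<lambda>i. if i = k then 1 else 0) has_sum (1 :: complex)) UNIV" for k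
      by (rule has_sum_finite_neutralI[of "{k}"]) auto
  qed
  moreover have "(\<Sum>k\<in>K. vscale V (if i = k then 1 else 0) (g k)) = g i" for i
  proof -
    have "(\<Sum>k\<in>K. vscale V (if i = k then 1 else 0) (g k)) = (\<Sum>k\<in>K. if i = k then g k else 0)"
      by (rule sum.cong) auto
    thus ?thesis using assms by (auto simp: K_def)
  qed
  ultimately show ?thesis by (simp add: K_def Sum_any.expand_set)
qed

text \<open>
  The linear functionals on a vector space separate its points.
\<close>
lemma has_vsum_unique:
  assumes "has_vsum V g I s" "has_vsum V g I t"
  shows "s = t"
proof (rule ccontr)
  assume "s \<noteq> t"
  interpret vp: vector_space_pair "vscale V" "(*) :: complex \<Rightarrow> complex \<Rightarrow> complex"
    by unfold_locales (simp_all add: algebra_simps)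
  have "independent {s - t}" using \<open>s \<noteq> t\<close> by (simp add: dependent_single)
  from vp.linear_independent_extend[OF this, of "\<lambda>_. 1"] obtain \<phi>
    where \<phi>: "Vector_Spaces.linear (vscale V) (*) \<phi>" "\<phi> (s - t) = (1 :: complex)" by auto
  have "\<phi> s = \<phi> t"
    by (rule has_sum_unique) (rule has_vsum_functional[OF _ \<phi>(1)], fact assms)+
  moreover have "\<phi> s = \<phi> (s - t) + \<phi> t" using functional_add[OF \<phi>(1), of "s - t" t] by simp
  ultimately show False using \<phi>(2) by simp
qed

text \<open>
  For large $n$ the sequence $g$ coincides with $g - h$, which is a combination of fixed vectors, and
  it has only finitely many other nonzero terms. This makes $\sum_n F_n g(n)$ converge, inside the span of
  finitely many vectors. The sum for $h$ is that for $g$ minus that for $g - h$.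
\<close>
lemma regular_kernel_vsums:
  fixes g h :: "int \<Rightarrow> 'v" and \<beta> :: "int \<Rightarrow> nat \<Rightarrow> complex"
  assumes g: "\<And>n. n < n0 \<Longrightarrow> g n = 0" and h: "\<And>n. n > n1 \<Longrightarrow> h n = 0"
    and gh: "\<And>n. g n - h n = (\<Sum>j<J. vscale V (\<beta> n j) (u j))"
    and F: "\<And>j. ((\<lambda>n. F n * \<beta> n j) has_sum s j) UNIV"
  obtains S where "has_vsum V (\<lambda>n. vscale V (F n) (g n)) UNIV S"
    "has_vsum V (\<lambda>n. vscale V (F n) (h n)) UNIV (S - (\<Sum>j<J. vscale V (s j) (u j)))"
proof -
  define x where "x = (\<lambda>j n. if n > n1 then F n * \<beta> n j else 0)"
  have "x j summable_on UNIV" for j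
  proof -
    have "(\<lambda>n. F n * \<beta> n j) summable_on {n. n > n1}"
      by (rule summable_on_subset_banach[of _ UNIV]) (use F[of j] in \<open>auto simp: summable_on_def\<close>)
    also have "?this \<longleftrightarrow> ?thesis"
      by (rule summable_on_cong_neutral) (auto simp: x_def)
    finally show ?thesis .
  qed
  hence x: "(x j has_sum infsum (x j) UNIV) UNIV" for j by simp
  define k where "k = (\<lambda>n. if n \<le> n1 then vscale V (F n) (g n) else 0)"
  have fin_k: "finite {n. k n \<noteq> 0}"
    by (rule finite_int_between[of _ n0 n1]) (use g in \<open>force simp: k_def not_less[symmetric] split: if_splits\<close>)
  define S where "S = Sum_any k + (\<Sum>j<J. vscale V (infsum (x j) UNIV) (u j))"
  have "has_vsum V (\<lambda>n. k n + (\<Sum>j<J. vscale V (x j n) (u j))) UNIV S"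
    unfolding S_def
    by (rule has_vsum_add[OF has_vsum_finite_support[OF fin_k] has_vsum_sum[OF has_vsum_smult[OF x]]])
  moreover have "k n + (\<Sum>j<J. vscale V (x j n) (u j)) = vscale V (F n) (g n)" for n
  proof (cases "n \<le> n1")
    case False
    hence "g n = (\<Sum>j<J. vscale V (\<beta> n j) (u j))" using gh[of n] h[of n] by simp
    thus ?thesis using False by (simp add: k_def x_def scale_sum_right)
  qed (simp add: k_def x_def)
  ultimately have S: "has_vsum V (\<lambda>n. vscale V (F n) (g n)) UNIV S" by simp
  have "has_vsum V (\<lambda>n. vscale V (F n) (g n) + vscale V (- 1) (\<Sum>j<J. vscale V (F n * \<beta> n j) (u j))) UNIV
      (S + vscale V (- 1) (\<Sum>j<J. vscale V (s j) (u j)))"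
    by (rule has_vsum_add[OF S has_vsum_scale[OF has_vsum_sum[OF has_vsum_smult[OF F]]]])
  moreover have "vscale V (F n) (g n) + vscale V (- 1) (\<Sum>j<J. vscale V (F n * \<beta> n j) (u j)) = vscale V (F n) (h n)" for n
  proof -
    have "h n = g n - (\<Sum>j<J. vscale V (\<beta> n j) (u j))" using gh[of n] by (simp add: algebra_simps)
    thus ?thesis by (simp add: scale_right_diff_distrib scale_sum_right sum_negf)
  qed
  ultimately show ?thesis using S by (intro that[of S]) simp_all
qed

end

section \<open>The Borcherds identity as a residue theorem\<close>

context vertex_algebra
begin

lemma mode_add_left: "mode V (a + a') n b = mode V a n b + mode V a' n b"
  using mode_linear_left by (simp only: Vector_Spaces.linear_iff)

lemma mode_scale_left: "mode V (vscale V s a) n b = vscale V s (mode V a n b)"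
  using mode_linear_left by (simp only: Vector_Spaces.linear_iff)

lemma mode_add_right: "mode V a n (b + b') = mode V a n b + mode V a n b'"
  using mode_linear_right by (simp only: Vector_Spaces.linear_iff)

lemma mode_scale_right: "mode V a n (vscale V s b) = vscale V s (mode V a n b)"
  using mode_linear_right by (simp only: Vector_Spaces.linear_iff)

lemma mode_zero_left [simp]: "mode V 0 n b = 0"
  using mode_scale_left[of 0 0 n b] by simp

lemma mode_zero_right [simp]: "mode V a n 0 = 0"
  using mode_scale_right[of a n 0 0] by simp

lemma mode_truncation:
  obtains K where "\<And>n. n \<ge> K \<Longrightarrow> mode V a n b = 0"
  by (rule that[of "- fls_subdegree (vop V a b)"]) (simp add: mode_def)

lemma Sum_any_scale_right:
  "finite {i. g i \<noteq> 0} \<Longrightarrow> vscale V s (Sum_any g) = Sum_any (\<lambda>i. vscale V s (g i))"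
  by (rule Sum_any_additive) (simp_all add: scale_right_distrib)

lemma nth_coord_fls_support:
  assumes "fls_nth (M * exp_fls p * coord_fls powi i) (- 1) \<noteq> 0"
  shows "i \<le> - 1 - fls_subdegree M"
proof (rule ccontr)
  assume *: "\<not> ?thesis"
  have "M \<noteq> 0" using assms by auto
  hence "fls_subdegree (M * exp_fls p * coord_fls powi i) = fls_subdegree M + i"
    by (subst fls_subdegree_mult; simp add: power_int_eq_0_iff)+
  thus False using * assms by simp
qed

lemma finite_bracket_term:
  "finite {j. vscale V (fls_nth (M * exp_fls d * coord_fls powi j) (- 1)) (mode V a (- j - 1) b) \<noteq> 0}"
proof -
  obtain K where K: "\<And>n. n \<ge> K \<Longrightarrow> mode V a n b = 0" using mode_truncation by blast
  show ?thesis
  proof (rule finite_int_between[of _ "- K" "- 1 - fls_subdegree M"])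
    fix i assume "i \<in> {j. vscale V (fls_nth (M * exp_fls d * coord_fls powi j) (- 1)) (mode V a (- j - 1) b) \<noteq> 0}"
    hence nz: "fls_nth (M * exp_fls d * coord_fls powi i) (- 1) \<noteq> 0" "mode V a (- i - 1) b \<noteq> 0" by auto
    from nz(2) K have "\<not> - i - 1 \<ge> K" by blast
    with nth_coord_fls_support[OF nz(1)] show "- K \<le> i \<and> i \<le> - 1 - fls_subdegree M" by linarith
  qed
qed

text \<open>
  For an expansion $M$ at $t = 0$ this is $\sum_j \rho_j(M)\,u_j$ in the notation of the introduction, with
  $j = -i-1$; here $\rho_j(M)$ is $2\pi i\,\mathrm{res}_t\,M\,x^p(x-1)^{-j-1}$ and $u_j$ is
  $(a_{(j)}b)_{(p+r-3-m-j)}\,w$. It is the coefficient of the $m$-th power of the formal variable in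
  $2\pi i\,X(a_{[f]}b,\cdot)\,w$ if $M$ is the expansion of $f$.
\<close>
definition bracket_pairing ::
    "'v \<Rightarrow> 'v \<Rightarrow> 'v \<Rightarrow> int \<Rightarrow> int \<Rightarrow> int \<Rightarrow> complex fls \<Rightarrow> 'v" where
  "bracket_pairing a b w p r m M = Sum_any (\<lambda>i. vscale V (2 * of_real pi * \<i> * fls_nth (M * exp_fls p * coord_fls powi i) (- 1))
        (mode V (mode V a (- i - 1) b) (p + r - 2 - m + i) w))"

lemma finite_bracket_pairing:
  "finite {i. vscale V (s * fls_nth (M * exp_fls p * coord_fls powi i) (- 1))
        (mode V (mode V a (- i - 1) b) (k + i) w) \<noteq> 0}"
  by (rule finite_subset[OF _ finite_bracket_term[of M p a b]]) auto

lemma bracket_pairing_add: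
  "bracket_pairing a b w p r m (M + M') = bracket_pairing a b w p r m M + bracket_pairing a b w p r m M'"
  unfolding bracket_pairing_def
  by (subst Sum_any.distrib[symmetric, OF finite_bracket_pairing finite_bracket_pairing])
     (simp add: ring_distribs scale_left_distrib)

lemma bracket_pairing_scale:
  "bracket_pairing a b w p r m (fls_const s * M) = vscale V s (bracket_pairing a b w p r m M)"
  unfolding bracket_pairing_def
  by (subst Sum_any_scale_right[OF finite_bracket_pairing]) (simp add: mult.assoc mult.left_commute[of s])

lemma bracket_pairing_sum:
  "bracket_pairing a b w p r m (\<Sum>k\<in>K. M k) = (\<Sum>k\<in>K. bracket_pairing a b w p r m (M k))"
proof -
  have "bracket_pairing a b w p r m 0 = 0" by (simp add: bracket_pairing_def)
  thus ?thesis
    by (induction K rule: infinite_finite_induct) (simp_all add: bracket_pairing_add)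
qed

lemma finite_outer_coeff:
  assumes "\<And>n. n < n0 \<Longrightarrow> g n = 0"
  shows "finite {n. vscale V (outer_coeff N n) (g n) \<noteq> 0}"
proof (rule finite_int_between[of _ n0 N])
  fix n assume "n \<in> {n. vscale V (outer_coeff N n) (g n) \<noteq> 0}"
  hence "outer_coeff N n \<noteq> 0" "g n \<noteq> 0" by auto
  moreover have "\<not> n < n0" using \<open>g n \<noteq> 0\<close> assms by blast
  ultimately show "n0 \<le> n \<and> n \<le> N" by (auto simp: outer_coeff_def split: if_splits)
qed

lemma finite_inner_coeff:
  assumes "\<And>n. n > n1 \<Longrightarrow> h n = 0"
  shows "finite {n. vscale V (inner_coeff N n) (h n) \<noteq> 0}"
proof (rule finite_int_between[of _ 0 n1])
  fix n assume "n \<in> {n. vscale V (inner_coeff N n) (h n) \<noteq> 0}"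
  hence "inner_coeff N n \<noteq> 0" "h n \<noteq> 0" by auto
  moreover have "\<not> n > n1" using \<open>h n \<noteq> 0\<close> assms by blast
  ultimately show "0 \<le> n \<and> n \<le> n1" by (auto simp: inner_coeff_def split: if_splits)
qed

text \<open>
  The theorem for $f = (e^{2\pi it}-1)^N$. By \<open>residue_exp_powi\<close> the left-hand side is
  $\sum_j \binom{p-1}{j} (a_{(N+j)}b)_{(p+r-3-m-N-j)}\,w$, which is the left-hand side of the
  Borcherds identity. The binomial coefficients on the other side of that identity are the coefficients of
  the two expansions of $(x-1)^N$.
\<close>
lemma bracket_pairing_power:
  fixes a b w p r m
  defines "g \<equiv> \<lambda>n. mode V a (p - 1 + n) (mode V b (r - 2 - m - n) w)"
    and "h \<equiv> \<lambda>n. mode V b (r - 2 - m - n) (mode V a (p - 1 + n) w)"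
  shows "bracket_pairing a b w p r m (coord_fls powi N) =
           Sum_any (\<lambda>n. vscale V (outer_coeff N n) (g n)) - Sum_any (\<lambda>n. vscale V (inner_coeff N n) (h n))"
proof -
  define u where "u = (\<lambda>j. mode V (mode V a j b) (p + r - 3 - m - j) w)"
  have co: "2 * of_real pi * \<i> * fls_nth (coord_fls powi N * exp_fls p * coord_fls powi i) (- 1) =
       (if N + i < 0 then of_int (p - 1) gchoose nat (- (N + i) - 1) else 0)" for i
  proof -
    have "coord_fls powi N * exp_fls p * coord_fls powi i = exp_fls p * coord_fls powi (N + i)"
      by (simp add: power_int_add mult_ac)
    thus ?thesis by (simp only: residue_exp_powi)
  qed
  have "bracket_pairing a b w p r m (coord_fls powi N) =
      Sum_any (\<lambda>i. vscale V (if N + i < 0 then of_int (p - 1) gchoose nat (- (N + i) - 1) else 0) (u (- i - 1)))"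
    unfolding bracket_pairing_def co u_def by (simp add: algebra_simps)
  also have "\<dots> = Sum_any (\<lambda>j::nat. vscale V (of_int (p - 1) gchoose j) (u (N + int j)))"
  proof (subst Sum_any_reindex[of "\<lambda>j::nat. - N - int j - 1"])
    show "inj (\<lambda>j::nat. - N - int j - 1)" by (auto simp: inj_on_def)
    show "vscale V (if N + n < 0 then of_int (p - 1) gchoose nat (- (N + n) - 1) else 0) (u (- n - 1)) = 0"
      if "n \<notin> range (\<lambda>j::nat. - N - int j - 1)" for n
    proof (cases "N + n < 0")
      case True
      hence "n = - N - int (nat (- N - n - 1)) - 1" by simp
      thus ?thesis using that by blast
    qed simp
  qed (simp add: algebra_simps)
  also have "\<dots> = Sum_any (\<lambda>j::nat. vscale V ((- 1) ^ j * (of_int N gchoose j)) (g (N - int j))) -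
                  Sum_any (\<lambda>j::nat. vscale V ((- 1) ^ j * (of_int N gchoose j) * (- 1) powi N) (h (int j)))"
    using borcherds[of "p - 1" a N b "r - 2 - m - N" w]
    by (simp add: u_def g_def h_def algebra_simps)
  also have "Sum_any (\<lambda>j::nat. vscale V ((- 1) ^ j * (of_int N gchoose j)) (g (N - int j))) =
             Sum_any (\<lambda>n. vscale V (outer_coeff N n) (g n))"
  proof (subst Sum_any_reindex[of "\<lambda>j::nat. N - int j" "\<lambda>n. vscale V (outer_coeff N n) (g n)"])
    show "vscale V (outer_coeff N n) (g n) = 0" if "n \<notin> range (\<lambda>j::nat. N - int j)" for n
    proof (cases "n \<le> N")
      case True
      hence "n = N - int (nat (N - n))" by simp
      thus ?thesis using that by blast
    qed (simp add: outer_coeff_def)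
  qed (auto simp: inj_on_def outer_coeff_def)
  also have "Sum_any (\<lambda>j::nat. vscale V ((- 1) ^ j * (of_int N gchoose j) * (- 1) powi N) (h (int j))) =
             Sum_any (\<lambda>n. vscale V (inner_coeff N n) (h n))"
  proof (subst Sum_any_reindex[of int "\<lambda>n. vscale V (inner_coeff N n) (h n)"])
    show "vscale V (inner_coeff N n) (h n) = 0" if "n \<notin> range int" for n
      using that by (cases "n \<ge> 0") (auto simp: inner_coeff_def image_iff elim: nonneg_int_cases)
  qed (auto simp: inner_coeff_def)
  finally show ?thesis .
qed

text \<open>
  The Borcherds identity with middle parameter $0$, where each of the two sums on the right-hand side
  reduces to its first term.
\<close>
lemma mode_commutator:
  assumes "\<And>j. j \<ge> int J \<Longrightarrow> mode V a j b = 0"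
  shows "mode V a k (mode V b l w) - mode V b l (mode V a k w) =
           (\<Sum>j<J. vscale V (of_int k gchoose j) (mode V (mode V a (int j) b) (k + l - int j) w))"
proof -
  have "Sum_any (\<lambda>j::nat. vscale V (of_int k gchoose j) (mode V (mode V a (int j) b) (k + l - int j) w)) =
     Sum_any (\<lambda>j::nat. vscale V ((- 1) ^ j * (0 gchoose j)) (mode V a (k - int j) (mode V b (l + int j) w))) -
     Sum_any (\<lambda>j::nat. vscale V ((- 1) ^ j * (0 gchoose j)) (mode V b (l - int j) (mode V a (k + int j) w)))"
    using borcherds[of k a 0 b l w] by simp
  also have "Sum_any (\<lambda>j::nat. vscale V ((- 1) ^ j * (0 gchoose j)) (mode V a (k - int j) (mode V b (l + int j) w))) =
      (\<Sum>j\<in>{0}. vscale V ((- 1) ^ j * (0 gchoose j)) (mode V a (k - int j) (mode V b (l + int j) w)))"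
    by (rule Sum_any.expand_superset) (auto simp: gbinomial_0_left split: if_splits)
  also have "Sum_any (\<lambda>j::nat. vscale V ((- 1) ^ j * (0 gchoose j)) (mode V b (l - int j) (mode V a (k + int j) w))) =
      (\<Sum>j\<in>{0}. vscale V ((- 1) ^ j * (0 gchoose j)) (mode V b (l - int j) (mode V a (k + int j) w)))"
    by (rule Sum_any.expand_superset) (auto simp: gbinomial_0_left split: if_splits)
  also have "Sum_any (\<lambda>j::nat. vscale V (of_int k gchoose j) (mode V (mode V a (int j) b) (k + l - int j) w)) =
      (\<Sum>j<J. vscale V (of_int k gchoose j) (mode V (mode V a (int j) b) (k + l - int j) w))"
  proof (rule Sum_any.expand_superset)
    show "{j. vscale V (of_int k gchoose j) (mode V (mode V a (int j) b) (k + l - int j) w) \<noteq> 0} \<subseteq> {..<J}"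
      using assms by (auto simp: not_less intro!: leI)
         (metis mode_zero_left not_less of_nat_le_iff)
  qed auto
  finally show ?thesis by simp
qed

text \<open>
  The theorem for homogeneous vectors, one coefficient at a time: \<open>L0\<close> is handled by
  \<open>regular_kernel_vsums\<close>, whose vectors are those of the commutator formula, and the powers of
  the coordinate by \<open>bracket_pairing_power\<close>.
\<close>
lemma mode_sums_eq_bracket_pairing:
  fixes a b w p r m
  defines "g \<equiv> \<lambda>n. mode V a (p - 1 + n) (mode V b (r - 2 - m - n) w)"
    and "h \<equiv> \<lambda>n. mode V b (r - 2 - m - n) (mode V a (p - 1 + n) w)"
  assumes L: "L = L0 + (\<Sum>k=1..P. fls_const (e k) * coord_fls powi (- int k))"
    and L0: "fls_subdegree L0 \<ge> 0"
    and Fp: "\<And>n. Fp n = F0 n + (\<Sum>k=1..P. e k * inner_coeff (- int k) n)"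
    and Fm: "\<And>n. Fm n = F0 n + (\<Sum>k=1..P. e k * outer_coeff (- int k) n)"
    and F0: "\<And>j. ((\<lambda>n. F0 n * (of_int (p - 1 + n) gchoose j)) has_sum
           2 * of_real pi * \<i> * fls_nth (L0 * exp_fls p * coord_fls powi (- int j - 1)) (- 1)) UNIV"
  shows "\<exists>S S'. has_vsum V (\<lambda>n. vscale V (Fm n) (g n)) UNIV S \<and>
                has_vsum V (\<lambda>n. vscale V (Fp n) (h n)) UNIV S' \<and>
                S - S' = bracket_pairing a b w p r m L"
proof -
  have vs: "vector_space (vscale V)" by unfold_locales
  define u where "u = (\<lambda>j. mode V (mode V a j b) (p + r - 3 - m - j) w)"
  obtain J where J: "\<And>j. j \<ge> int J \<Longrightarrow> mode V a j b = 0"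
    by (rule mode_truncation[of a b]) (metis int_nat_eq le_cases nat_le_iff order_trans)
  obtain Ka where Ka: "\<And>n. n \<ge> Ka \<Longrightarrow> mode V a n w = 0" using mode_truncation by blast
  obtain Kb where Kb: "\<And>n. n \<ge> Kb \<Longrightarrow> mode V b n w = 0" using mode_truncation by blast
  have g0: "g n = 0" if "n < r - 2 - m - Kb" for n using Kb[of "r - 2 - m - n"] that by (simp add: g_def)
  have h0: "h n = 0" if "n > Ka - p" for n using Ka[of "p - 1 + n"] that by (simp add: h_def)
  have gh: "g n - h n = (\<Sum>j<J. vscale V (of_int (p - 1 + n) gchoose j) (u (int j)))" for n
  proof -
    have "g n - h n = (\<Sum>j<J. vscale V (of_int (p - 1 + n) gchoose j)
        (mode V (mode V a (int j) b) (p - 1 + n + (r - 2 - m - n) - int j) w))"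
      unfolding g_def h_def by (rule mode_commutator) (rule J)
    also have "p - 1 + n + (r - 2 - m - n) = p + r - 3 - m" by simp
    finally show ?thesis by (simp only: u_def)
  qed
  obtain S where S: "has_vsum V (\<lambda>n. vscale V (F0 n) (g n)) UNIV S"
    "has_vsum V (\<lambda>n. vscale V (F0 n) (h n)) UNIV
       (S - (\<Sum>j<J. vscale V (2 * of_real pi * \<i> * fls_nth (L0 * exp_fls p * coord_fls powi (- int j - 1)) (- 1)) (u (int j))))"
    by (rule regular_kernel_vsums[OF vs g0 h0 gh F0])
  define Qm where "Qm = (\<lambda>k. Sum_any (\<lambda>n. vscale V (outer_coeff (- int k) n) (g n)))"
  define Qp where "Qp = (\<lambda>k. Sum_any (\<lambda>n. vscale V (inner_coeff (- int k) n) (h n)))"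
  have Qm: "has_vsum V (\<lambda>n. vscale V (outer_coeff (- int k) n) (g n)) UNIV (Qm k)" for k
    unfolding Qm_def by (rule has_vsum_finite_support[OF vs finite_outer_coeff[OF g0]])
  have Qp: "has_vsum V (\<lambda>n. vscale V (inner_coeff (- int k) n) (h n)) UNIV (Qp k)" for k
    unfolding Qp_def by (rule has_vsum_finite_support[OF vs finite_inner_coeff[OF h0]])
  \<comment> \<open>For a regular expansion only the $u_j$ with $j \<ge> 0$ contribute, as in the commutator formula.\<close>
  have "bracket_pairing a b w p r m L0 =
      Sum_any (\<lambda>j::nat. vscale V (2 * of_real pi * \<i> * fls_nth (L0 * exp_fls p * coord_fls powi (- int j - 1)) (- 1)) (u (int j)))"
    unfolding bracket_pairing_def
  proof (subst Sum_any_reindex[of "\<lambda>j::nat. - int j - 1"])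
    show "vscale V (2 * of_real pi * \<i> * fls_nth (L0 * exp_fls p * coord_fls powi i) (- 1))
        (mode V (mode V a (- i - 1) b) (p + r - 2 - m + i) w) = 0"
      if "i \<notin> range (\<lambda>j::nat. - int j - 1)" for i
    proof (cases "i \<ge> 0")
      case True
      hence "fls_nth (L0 * exp_fls p * coord_fls powi i) (- 1) = 0" using nth_coord_fls_support[of L0 p i] L0 by fastforce
      thus ?thesis by simp
    next
      case False
      hence "i = - int (nat (- i - 1)) - 1" by simp
      thus ?thesis using that by blast
    qed
  qed (auto simp: inj_on_def u_def algebra_simps)
  also have "\<dots> = (\<Sum>j<J. vscale V (2 * of_real pi * \<i> * fls_nth (L0 * exp_fls p * coord_fls powi (- int j - 1)) (- 1)) (u (int j)))"
  proof (rule Sum_any.expand_superset)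
    have "u (int j) = 0" if "\<not> j < J" for j using J[of "int j"] that by (simp add: u_def)
    thus "{j. vscale V (2 * of_real pi * \<i> * fls_nth (L0 * exp_fls p * coord_fls powi (- int j - 1)) (- 1)) (u (int j)) \<noteq> 0} \<subseteq> {..<J}"
      by fastforce
  qed simp
  finally have pair0: "bracket_pairing a b w p r m L0 = \<dots>" .
  have pairk: "bracket_pairing a b w p r m (coord_fls powi (- int k)) = Qm k - Qp k" for k
    unfolding Qm_def Qp_def g_def h_def by (rule bracket_pairing_power)
  have "has_vsum V (\<lambda>n. vscale V (F0 n) (g n) + (\<Sum>k=1..P. vscale V (e k) (vscale V (outer_coeff (- int k) n) (g n)))) UNIV
      (S + (\<Sum>k=1..P. vscale V (e k) (Qm k)))"
    by (rule has_vsum_add[OF vs S(1) has_vsum_sum[OF vs has_vsum_scale[OF vs Qm]]])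
  hence 1: "has_vsum V (\<lambda>n. vscale V (Fm n) (g n)) UNIV (S + (\<Sum>k=1..P. vscale V (e k) (Qm k)))"
    by (simp add: Fm scale_left_distrib scale_sum_left)
  have "has_vsum V (\<lambda>n. vscale V (F0 n) (h n) + (\<Sum>k=1..P. vscale V (e k) (vscale V (inner_coeff (- int k) n) (h n)))) UNIV
      (S - bracket_pairing a b w p r m L0 + (\<Sum>k=1..P. vscale V (e k) (Qp k)))"
    unfolding pair0 by (rule has_vsum_add[OF vs S(2) has_vsum_sum[OF vs has_vsum_scale[OF vs Qp]]])
  hence 2: "has_vsum V (\<lambda>n. vscale V (Fp n) (h n)) UNIV
      (S - bracket_pairing a b w p r m L0 + (\<Sum>k=1..P. vscale V (e k) (Qp k)))"
    by (simp add: Fp scale_left_distrib scale_sum_left)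
  have "bracket_pairing a b w p r m L = bracket_pairing a b w p r m L0 + (\<Sum>k=1..P. vscale V (e k) (Qm k - Qp k))"
    by (simp only: L bracket_pairing_add bracket_pairing_sum bracket_pairing_scale pairk)
  also have "\<dots> = (S + (\<Sum>k=1..P. vscale V (e k) (Qm k))) -
      (S - bracket_pairing a b w p r m L0 + (\<Sum>k=1..P. vscale V (e k) (Qp k)))"
    by (simp add: scale_right_diff_distrib sum_subtractf algebra_simps)
  finally show ?thesis using 1 2 by metis
qed

end

section \<open>The grading by conformal weight\<close>

context vertex_algebra
begin

lemma nth_vop: "fls_nth (vop V a b) k = mode V a (- k - 1) b"
  by (simp add: mode_def)

lemma vop_zero_left [simp]: "vop V 0 b = 0"
  by (rule fls_eqI) (simp add: nth_vop)

lemma Lop_add: "Lop V n (x + y) = Lop V n x + Lop V n y"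
  by (simp add: Lop_def mode_add_right)

lemma Lop_scale: "Lop V n (vscale V s x) = vscale V s (Lop V n x)"
  by (simp add: Lop_def mode_scale_right)

lemma Lop_zero [simp]: "Lop V n 0 = 0"
  by (simp add: Lop_def)

lemma Lop_sum: "Lop V n (\<Sum>i\<in>I. g i) = (\<Sum>i\<in>I. Lop V n (g i))"
  by (induction I rule: infinite_finite_induct) (simp_all add: Lop_add)

lemma wt_space_zero [simp]: "0 \<in> wt_space V d"
  by (simp add: wt_space_def)

lemma wt_space_add: "x \<in> wt_space V d \<Longrightarrow> y \<in> wt_space V d \<Longrightarrow> x + y \<in> wt_space V d"
  by (simp add: wt_space_def Lop_add scale_right_distrib)

lemma wt_space_scale: "x \<in> wt_space V d \<Longrightarrow> vscale V s x \<in> wt_space V d"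
  by (simp add: wt_space_def Lop_scale scale_left_commute)

text \<open>
  Eigenvectors of $L_0$ for distinct eigenvalues: applying $L_0 - e$ removes the component of weight
  $e$ and multiplies the others by nonzero scalars.
\<close>
lemma weight_spaces_independent:
  assumes "finite D" "\<And>d. d \<in> D \<Longrightarrow> h d \<in> wt_space V d" "(\<Sum>d\<in>D. h d) = 0" "d \<in> D"
  shows "h d = 0"
  using assms
proof (induction D arbitrary: h d rule: finite_induct)
  case (insert e D)
  have L: "Lop V 0 (h d) = vscale V (of_nat d) (h d)" if "d \<in> insert e D" for d
    using insert.prems(1)[OF that] by (simp add: wt_space_def)
  have "0 = Lop V 0 (\<Sum>d\<in>insert e D. h d) - vscale V (of_nat e) (\<Sum>d\<in>insert e D. h d)"
    unfolding insert.prems(2) by simp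
  also have "\<dots> = (\<Sum>d\<in>insert e D. vscale V (of_nat d - of_nat e) (h d))"
    by (simp only: Lop_sum scale_sum_right L scale_left_diff_distrib sum_subtractf cong: sum.cong)
  also have "\<dots> = (\<Sum>d\<in>D. vscale V (of_nat d - of_nat e) (h d))"
    using insert.hyps by simp
  finally have *: "(\<Sum>d\<in>D. vscale V (of_nat d - of_nat e) (h d)) = 0" by simp
  have D: "h d' = 0" if "d' \<in> D" for d'
  proof -
    have "vscale V (of_nat d' - of_nat e) (h d') = 0"
      by (rule insert.IH[OF _ * that]) (use insert.prems(1) in \<open>auto intro: wt_space_scale\<close>)
    moreover have "(of_nat d' - of_nat e :: complex) \<noteq> 0" using that insert.hyps(2) by auto
    ultimately show ?thesis by simp
  qed
  hence "h e = 0" using insert.prems(2) insert.hyps by simp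
  thus ?case using D insert.prems(3) by auto
qed simp

lemma hcomp_unique:
  assumes "\<And>d. h d \<in> wt_space V d" "finite {d. h d \<noteq> 0}" "v = Sum_any h"
    "\<And>d. h' d \<in> wt_space V d" "finite {d. h' d \<noteq> 0}" "v = Sum_any h'"
  shows "h = h'"
proof
  fix d
  define D where "D = insert d ({d. h d \<noteq> 0} \<union> {d. h' d \<noteq> 0})"
  have "finite D" using assms by (simp add: D_def)
  have "Sum_any h = sum h D" "Sum_any h' = sum h' D"
    by (rule Sum_any.expand_superset[OF \<open>finite D\<close>]; auto simp: D_def)+
  hence "(\<Sum>d\<in>D. h d + vscale V (- 1) (h' d)) = 0"
    using assms(3,6) by (simp add: sum_subtractf)
  moreover have "h d + vscale V (- 1) (h' d) \<in> wt_space V d" for d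
    by (intro wt_space_add wt_space_scale assms)
  ultimately have "h d + vscale V (- 1) (h' d) = 0"
    using weight_spaces_independent[OF \<open>finite D\<close>, of "\<lambda>d. h d + vscale V (- 1) (h' d)" d]
    by (simp add: D_def)
  thus "h d = h' d" by simp
qed

lemma hcomp_eqI:
  assumes "\<And>d. h d \<in> wt_space V d" "finite {d. h d \<noteq> 0}" "v = Sum_any h"
  shows "hcomp V v = h"
  unfolding hcomp_def by (rule the_equality) (use assms hcomp_unique[OF assms] in blast)+

lemma hcomp_homogeneous:
  assumes "v \<in> wt_space V p"
  shows "hcomp V v = (\<lambda>d. if d = p then v else 0)"
proof (rule hcomp_eqI)
  show "finite {d. (if d = p then v else 0) \<noteq> 0}" by (rule finite_subset[of _ "{p}"]) auto
qed (use assms in auto)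

text \<open>
  The rule $(Ta)_{(k)} = -k\,a_{(k-1)}$ for $Ta = a_{(-2)}\mathbf 1$. The Borcherds identity expresses
  $(a_{(-2)}\mathbf 1)_{(k)}$ by products of modes of $a$ and of $\mathbf 1$, in which
  $\mathbf 1_{(n)} = 0$ for $n \ne -1$ leaves one term at most: it comes from the first sum for
  $k \<le> -1$, from the second one for $k \<ge> 1$, and is absent for $k = 0$.
\<close>
lemma translation_mode:
  "mode V (mode V a (- 2) (vac V)) k b = vscale V (- of_int k) (mode V a (k - 1) b)"
proof -
  have c: "(- 1) ^ j * ((- 2 :: complex) gchoose j) = of_nat (Suc j)" for j
  proof -
    have "(- 2 :: complex) gchoose j = (- 1) ^ j * (of_nat (Suc j) gchoose j)"
      by (subst gbinomial_negated_upper) simp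
    also have "(of_nat (Suc j) gchoose j :: complex) = of_nat (Suc j choose j)"
      by (rule binomial_gbinomial[symmetric])
    finally show ?thesis by simp
  qed
  have "mode V (mode V a (- 2) (vac V)) k b =
      Sum_any (\<lambda>j::nat. vscale V (0 gchoose j) (mode V (mode V a (- 2 + int j) (vac V)) (k - int j) b))"
  proof -
    have "Sum_any (\<lambda>j::nat. vscale V (0 gchoose j) (mode V (mode V a (- 2 + int j) (vac V)) (k - int j) b)) =
       (\<Sum>j\<in>{0}. vscale V (0 gchoose j) (mode V (mode V a (- 2 + int j) (vac V)) (k - int j) b))"
      by (rule Sum_any.expand_superset) (auto simp: gbinomial_0_left split: if_splits)
    thus ?thesis by simp
  qed
  also have "\<dots> = Sum_any (\<lambda>j::nat. vscale V (of_nat (Suc j)) (mode V a (- 2 - int j) (mode V (vac V) (k + int j) b))) -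
      Sum_any (\<lambda>j::nat. vscale V (of_nat (Suc j)) (mode V (vac V) (- 2 + k - int j) (mode V a (int j) b)))"
    using borcherds[of 0 a "- 2" "vac V" k b] by (simp only: of_int_0 add_0_left of_int_minus of_int_numeral c) (simp add: power_int_minus c)
  also have "Sum_any (\<lambda>j::nat. vscale V (of_nat (Suc j)) (mode V a (- 2 - int j) (mode V (vac V) (k + int j) b))) =
      Sum_any (\<lambda>j::nat. if j = nat (- 1 - k) then (if k \<le> - 1 then vscale V (- of_int k) (mode V a (k - 1) b) else 0) else 0)"
    by (rule arg_cong[where f = Sum_any]) (auto simp: vacuum fun_eq_iff nat_eq_iff algebra_simps)
  also have "\<dots> = (if k \<le> - 1 then vscale V (- of_int k) (mode V a (k - 1) b) else 0)"
    by simp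
  also have "Sum_any (\<lambda>j::nat. vscale V (of_nat (Suc j)) (mode V (vac V) (- 2 + k - int j) (mode V a (int j) b))) =
      Sum_any (\<lambda>j::nat. if j = nat (k - 1) then (if k \<ge> 1 then vscale V (of_int k) (mode V a (k - 1) b) else 0) else 0)"
    by (rule arg_cong[where f = Sum_any]) (auto simp: vacuum fun_eq_iff nat_eq_iff algebra_simps)
  also have "\<dots> = (if k \<ge> 1 then vscale V (of_int k) (mode V a (k - 1) b) else 0)"
    by simp
  finally show ?thesis by (cases k "0 :: int" rule: linorder_cases) auto
qed

end

context conformal_vertex_algebra
begin

text \<open>
  The commutator of $L_0 = \omega_{(1)}$ with $a_{(j)}$ has the two terms $(\omega_{(0)}a)_{(j+1)}$ and
  $(\omega_{(1)}a)_{(j)}$. The first is $(Ta)_{(j+1)} = -(j+1)\,a_{(j)}$, because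
  $\omega_{(0)} = L_{-1}$ is the translation operator, and the second is $p\,a_{(j)}$.
\<close>
lemma mode_weight:
  assumes "a \<in> wt_space V p" "b \<in> wt_space V r"
  shows "Lop V 0 (mode V a j b) = vscale V (of_int (int p + int r - j - 1)) (mode V a j b)"
proof -
  obtain K where K: "\<And>n. n \<ge> K \<Longrightarrow> mode V (conf V) n a = 0" using mode_truncation by blast
  define J where "J = max 2 (nat K)"
  have "mode V (conf V) 1 (mode V a j b) - mode V a j (mode V (conf V) 1 b) =
      (\<Sum>i<J. vscale V (of_int 1 gchoose i) (mode V (mode V (conf V) (int i) a) (1 + j - int i) b))"
    by (rule mode_commutator) (rule K, simp add: J_def)
  also have "\<dots> = (\<Sum>i\<in>{0,1}. vscale V (of_int 1 gchoose i) (mode V (mode V (conf V) (int i) a) (1 + j - int i) b))"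
  proof (rule sum.mono_neutral_right)
    show "\<forall>i\<in>{..<J} - {0, 1}. vscale V (of_int 1 gchoose i) (mode V (mode V (conf V) (int i) a) (1 + j - int i) b) = 0"
    proof
      fix i assume "i \<in> {..<J} - {0, 1}"
      hence "1 < i" by auto
      hence "(of_nat 1 gchoose i :: complex) = 0" unfolding binomial_gbinomial[symmetric] by simp
      thus "vscale V (of_int 1 gchoose i) (mode V (mode V (conf V) (int i) a) (1 + j - int i) b) = 0" by simp
    qed
  qed (auto simp: J_def)
  also have "\<dots> = mode V (Lop V (- 1) a) (j + 1) b + mode V (Lop V 0 a) j b"
    by (simp add: Lop_def add.commute)
  also have "mode V (Lop V (- 1) a) (j + 1) b = vscale V (- of_int (j + 1)) (mode V a j b)"
    unfolding translation translation_mode by simp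
  also have "mode V (Lop V 0 a) j b = vscale V (of_nat p) (mode V a j b)"
    using assms(1) by (simp add: wt_space_def mode_scale_left)
  finally have "Lop V 0 (mode V a j b) = mode V a j (Lop V 0 b) + (vscale V (- of_int (j + 1)) (mode V a j b) + vscale V (of_nat p) (mode V a j b))"
    by (simp add: Lop_def algebra_simps)
  also have "mode V a j (Lop V 0 b) = vscale V (of_nat r) (mode V a j b)"
    using assms(2) by (simp add: wt_space_def mode_scale_right)
  finally show ?thesis by (simp add: algebra_simps)
qed

lemma hcomp_exists: "\<exists>h. (\<forall>d. h d \<in> wt_space V d) \<and> finite {d. h d \<noteq> 0} \<and> v = Sum_any h"
proof -
  have "v \<in> span (\<Union>d. wt_space V d)" using graded by simp
  thus ?thesis
  proof (induction rule: span_induct)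
    case base
    show ?case
    proof (rule subspaceI, goal_cases)
      case 1
      show ?case by (intro CollectI exI[of _ "\<lambda>_. 0"]) simp
    next
      case (2 x y)
      then obtain h h' where h: "\<forall>d. h d \<in> wt_space V d" "finite {d. h d \<noteq> 0}" "x = Sum_any h"
        and h': "\<forall>d. h' d \<in> wt_space V d" "finite {d. h' d \<noteq> 0}" "y = Sum_any h'" by blast
      have "finite {d. h d + h' d \<noteq> 0}"
        by (rule finite_subset[OF _ finite_UnI[OF h(2) h'(2)]]) auto
      thus ?case using h h'
        by (intro CollectI exI[of _ "\<lambda>d. h d + h' d"]) (simp add: wt_space_add Sum_any.distrib)
    next
      case (3 s x)
      then obtain h where h: "\<forall>d. h d \<in> wt_space V d" "finite {d. h d \<noteq> 0}" "x = Sum_any h" by blast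
      have "finite {d. vscale V s (h d) \<noteq> 0}"
        by (rule finite_subset[OF _ h(2)]) auto
      thus ?case using h
        by (intro CollectI exI[of _ "\<lambda>d. vscale V s (h d)"]) (simp add: wt_space_scale Sum_any_scale_right)
    qed
  next
    case (step x)
    then obtain p where p: "x \<in> wt_space V p" by blast
    have "finite {d. (if d = p then x else 0) \<noteq> 0}" by (rule finite_subset[of _ "{p}"]) auto
    thus ?case using p by (intro exI[of _ "\<lambda>d. if d = p then x else 0"]) auto
  qed
qed

lemma hcomp: "hcomp V v d \<in> wt_space V d" "finite {d. hcomp V v d \<noteq> 0}" "Sum_any (hcomp V v) = v"
proof -
  obtain h where h: "\<forall>d. h d \<in> wt_space V d" "finite {d. h d \<noteq> 0}" "v = Sum_any h"
    using hcomp_exists by blast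
  hence "hcomp V v = h" by (intro hcomp_eqI) auto
  thus "hcomp V v d \<in> wt_space V d" "finite {d. hcomp V v d \<noteq> 0}" "Sum_any (hcomp V v) = v"
    using h by auto
qed

lemma hcomp_add: "hcomp V (x + y) d = hcomp V x d + hcomp V y d"
proof -
  have "finite {d. hcomp V x d + hcomp V y d \<noteq> 0}"
    by (rule finite_subset[OF _ finite_UnI[OF hcomp(2)[of x] hcomp(2)[of y]]]) auto
  hence "hcomp V (x + y) = (\<lambda>d. hcomp V x d + hcomp V y d)"
    by (intro hcomp_eqI) (simp_all add: wt_space_add hcomp Sum_any.distrib)
  thus ?thesis by simp
qed

lemma hcomp_scale: "hcomp V (vscale V s x) d = vscale V s (hcomp V x d)"
proof -
  have "finite {d. vscale V s (hcomp V x d) \<noteq> 0}"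
    by (rule finite_subset[OF _ hcomp(2)[of x]]) auto
  hence "hcomp V (vscale V s x) = (\<lambda>d. vscale V s (hcomp V x d))"
    by (intro hcomp_eqI) (simp_all add: wt_space_scale hcomp flip: Sum_any_scale_right)
  thus ?thesis by simp
qed

text \<open>
  The spectrum of $L_0$ consists of natural numbers. Therefore $a_{(j)}b$ vanishes when its weight,
  computed as an integer, is negative, and the formula for $X$ on a homogeneous vector holds with integer
  weights (\<open>Xop_homogeneous\<close>).
\<close>
lemma integer_weight:
  assumes "Lop V 0 v = vscale V (of_int k) v"
  shows "v = 0 \<or> (k \<ge> 0 \<and> v \<in> wt_space V (nat k))"
proof -
  define D where "D = {d. hcomp V v d \<noteq> 0}"
  have D: "finite D" by (simp add: D_def hcomp)
  have v: "v = (\<Sum>d\<in>D. hcomp V v d)"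
    using hcomp(3)[of v] by (simp add: D_def Sum_any.expand_set)
  have L: "Lop V 0 (hcomp V v d) = vscale V (of_nat d) (hcomp V v d)" for d
    using hcomp(1)[of v d] by (simp add: wt_space_def)
  have "0 = Lop V 0 (\<Sum>d\<in>D. hcomp V v d) - vscale V (of_int k) (\<Sum>d\<in>D. hcomp V v d)"
    using assms v by simp
  also have "\<dots> = (\<Sum>d\<in>D. vscale V (of_nat d - of_int k) (hcomp V v d))"
    by (simp only: Lop_sum scale_sum_right L scale_left_diff_distrib sum_subtractf)
  finally have *: "(\<Sum>d\<in>D. vscale V (of_nat d - of_int k) (hcomp V v d)) = 0" by simp
  have d: "of_nat d = (of_int k :: complex)" if "d \<in> D" for d
  proof -
    have "vscale V (of_nat d - of_int k) (hcomp V v d) = 0"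
      by (rule weight_spaces_independent[OF D _ * that]) (auto intro: wt_space_scale hcomp)
    thus ?thesis using that by (simp add: D_def)
  qed
  show ?thesis
  proof (cases "D = {}")
    case False
    then obtain d where "d \<in> D" by blast
    hence "of_int (int d) = (of_int k :: complex)" using d by simp
    hence "k = int d" by (simp only: of_int_eq_iff)
    thus ?thesis using assms by (simp add: wt_space_def)
  qed (use v in simp)
qed

lemma nth_Xop: "fls_nth (Xop V a b) k = Sum_any (\<lambda>d. mode V (hcomp V a d) (int d - 2 - k) b)"
proof -
  have "finite {d. fls_shift (1 - int d) (vop V (hcomp V a d) b) \<noteq> 0}"
    by (rule finite_subset[OF _ hcomp(2)[of a]]) auto
  hence "fls_nth (Xop V a b) k = Sum_any (\<lambda>d. fls_nth (fls_shift (1 - int d) (vop V (hcomp V a d) b)) k)"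
    unfolding Xop_def by (intro Sum_any_additive) auto
  thus ?thesis by (simp add: nth_vop algebra_simps)
qed

lemma finite_hcomp_mode: "finite {d. mode V (hcomp V a d) (e d) (t d) \<noteq> 0}"
  by (rule finite_subset[OF _ hcomp(2)[of a]]) auto

lemma Xop_homogeneous:
  assumes "Lop V 0 v = vscale V (of_int k) v"
  shows "fls_nth (Xop V v b) m = mode V v (k - 2 - m) b"
proof (cases "v = 0")
  case True
  have "hcomp V 0 = (\<lambda>_. 0)" using hcomp_homogeneous[OF wt_space_zero[of 0]] by auto
  thus ?thesis using True by (simp add: nth_Xop)
next
  case False
  hence "k \<ge> 0" "v \<in> wt_space V (nat k)" using integer_weight[OF assms] by auto
  hence "fls_nth (Xop V v b) m = Sum_any (\<lambda>d. if d = nat k then mode V v (k - 2 - m) b else 0)"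
    unfolding nth_Xop hcomp_homogeneous[OF \<open>v \<in> wt_space V (nat k)\<close>]
    by (intro arg_cong[where f = Sum_any]) auto
  thus ?thesis by simp
qed

lemma Xop_add_left: "fls_nth (Xop V (a + a') b) k = fls_nth (Xop V a b) k + fls_nth (Xop V a' b) k"
  unfolding nth_Xop hcomp_add mode_add_left by (rule Sum_any.distrib) (rule finite_hcomp_mode)+

lemma Xop_add_right: "fls_nth (Xop V a (b + b')) k = fls_nth (Xop V a b) k + fls_nth (Xop V a b') k"
  unfolding nth_Xop mode_add_right by (rule Sum_any.distrib) (rule finite_hcomp_mode)+

lemma Xop_scale_left: "fls_nth (Xop V (vscale V s a) b) k = vscale V s (fls_nth (Xop V a b) k)"
  unfolding nth_Xop hcomp_scale mode_scale_left by (rule Sum_any_scale_right[symmetric]) (rule finite_hcomp_mode)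

lemma Xop_scale_right: "fls_nth (Xop V a (vscale V s b)) k = vscale V s (fls_nth (Xop V a b) k)"
  unfolding nth_Xop mode_scale_right by (rule Sum_any_scale_right[symmetric]) (rule finite_hcomp_mode)

end

section \<open>The product defined by a periodic function\<close>

lemma fls_times_nth_Sum_any:
  fixes p q :: "complex fls"
  shows "fls_nth (p * q) k = Sum_any (\<lambda>i. fls_nth p i * fls_nth q (k - i))"
proof -
  have "Sum_any (\<lambda>i. fls_nth p i * fls_nth q (k - i)) =
      (\<Sum>i=fls_subdegree p..k - fls_subdegree q. fls_nth p i * fls_nth q (k - i))"
  proof (rule Sum_any.expand_superset)
    show "{i. fls_nth p i * fls_nth q (k - i) \<noteq> 0} \<subseteq> {fls_subdegree p..k - fls_subdegree q}"
    proof
      fix i assume "i \<in> {i. fls_nth p i * fls_nth q (k - i) \<noteq> 0}"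
      hence "fls_nth p i \<noteq> 0" "fls_nth q (k - i) \<noteq> 0" by auto
      hence "i \<ge> fls_subdegree p" "k - i \<ge> fls_subdegree q" by (meson fls_subdegree_leI)+
      thus "i \<in> {fls_subdegree p..k - fls_subdegree q}" by simp
    qed
  qed simp
  thus ?thesis by (simp add: fls_times_nth(2))
qed

context vertex_algebra
begin

lemma Sum_any_scale_left:
  "finite {i. x i \<noteq> 0} \<Longrightarrow> vscale V (Sum_any x) v = Sum_any (\<lambda>i. vscale V (x i) v)"
  by (rule Sum_any_additive[where f = "\<lambda>s. vscale V s v"]) (simp_all add: scale_left_distrib)

text \<open>
  Multiplication by $q$ may be carried out inside a sum $\sum_j \gamma_j(t)\,F_j$ in which $\gamma_j$ has
  order $j$: only finitely many pairs of indices contribute to a given coefficient. It is used twice in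
  unfolding $a_{[f]}b$, first for $\gamma_j = (x-1)^j$ and then for $\gamma_j = x^d (x-1)^j$.
\<close>
lemma convolution_family:
  assumes \<gamma>: "\<And>j. fls_subdegree (\<gamma> j) = j" 
  shows "Sum_any (\<lambda>i. vscale V (fls_nth q i) (Sum_any (\<lambda>j. vscale V (fls_nth (\<gamma> j) (k - i)) (fls_nth F j)))) =
         Sum_any (\<lambda>j. vscale V (fls_nth (q * \<gamma> j) k) (fls_nth F j))"
proof -
  define s where "s = fls_subdegree q"
  define t where "t = fls_subdegree F"
  have q: "i \<ge> s" if "fls_nth q i \<noteq> 0" for i using that unfolding s_def by (meson fls_subdegree_leI)
  have F: "j \<ge> t" if "fls_nth F j \<noteq> 0" for j using that unfolding t_def by (meson fls_subdegree_leI)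
  have g: "n \<ge> j" if "fls_nth (\<gamma> j) n \<noteq> 0" for n j using that \<gamma> by (metis fls_subdegree_leI)
  define T where "T = (\<lambda>i j. vscale V (fls_nth q i * fls_nth (\<gamma> j) (k - i)) (fls_nth F j))"
  have T: "s \<le> i \<and> i \<le> k - j \<and> t \<le> j" if "T i j \<noteq> 0" for i j
    using that q[of i] F[of j] g[of j "k - i"] by (auto simp: T_def)
  have "Sum_any (\<lambda>i. vscale V (fls_nth q i) (Sum_any (\<lambda>j. vscale V (fls_nth (\<gamma> j) (k - i)) (fls_nth F j)))) =
      Sum_any (\<lambda>i. Sum_any (T i))"
  proof (rule arg_cong[where f = Sum_any], rule ext)
    fix i
    have "finite {j. vscale V (fls_nth (\<gamma> j) (k - i)) (fls_nth F j) \<noteq> 0}"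
    proof (rule finite_int_between[of _ t "k - i"])
      fix j assume "j \<in> {j. vscale V (fls_nth (\<gamma> j) (k - i)) (fls_nth F j) \<noteq> 0}"
      hence "fls_nth (\<gamma> j) (k - i) \<noteq> 0" "fls_nth F j \<noteq> 0" by auto
      thus "t \<le> j \<and> j \<le> k - i" using g F by blast
    qed
    thus "vscale V (fls_nth q i) (Sum_any (\<lambda>j. vscale V (fls_nth (\<gamma> j) (k - i)) (fls_nth F j))) = Sum_any (T i)"
      by (subst Sum_any_scale_right) (simp_all add: T_def)
  qed
  also have "\<dots> = Sum_any (\<lambda>j. Sum_any (\<lambda>i. T i j))"
  proof (rule Sum_any.swap)
    show "finite ({s..k - t} \<times> {t..k - s})" by simp
    show "{i. \<exists>j. T i j \<noteq> 0} \<times> {j. \<exists>i. T i j \<noteq> 0} \<subseteq> {s..k - t} \<times> {t..k - s}"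
      using T by fastforce
  qed
  also have "\<dots> = Sum_any (\<lambda>j. vscale V (fls_nth (q * \<gamma> j) k) (fls_nth F j))"
  proof (rule arg_cong[where f = Sum_any], rule ext)
    fix j
    have "finite {i. fls_nth q i * fls_nth (\<gamma> j) (k - i) \<noteq> 0}"
    proof (rule finite_int_between[of _ s "k - j"])
      fix i assume "i \<in> {i. fls_nth q i * fls_nth (\<gamma> j) (k - i) \<noteq> 0}"
      hence "fls_nth q i \<noteq> 0" "fls_nth (\<gamma> j) (k - i) \<noteq> 0" by auto
      thus "s \<le> i \<and> i \<le> k - j" using q g[of j "k - i"] by auto
    qed
    thus "Sum_any (\<lambda>i. T i j) = vscale V (fls_nth (q * \<gamma> j) k) (fls_nth F j)"
      unfolding fls_times_nth_Sum_any T_def by (rule Sum_any_scale_left[symmetric])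
  qed
  finally show ?thesis .
qed

lemma nth_bracket_summand:
  "fls_nth (fls_vmult V (exp_fls d) (fls_vsubst V F coord_fls)) k =
     Sum_any (\<lambda>j. vscale V (fls_nth (exp_fls d * coord_fls powi j) k) (fls_nth F j))"
proof -
  have vs: "vector_space (vscale V)" by unfold_locales
  show ?thesis
    unfolding fls_nth_vmult[OF vs]
    by (subst fls_nth_vsubst[OF vs]) (simp, rule convolution_family, simp)
qed

lemma finite_vmult: "finite {i. vscale V (fls_nth p i) (fls_nth F (k - i)) \<noteq> 0}"
proof (rule finite_int_between[of _ "fls_subdegree p" "k - fls_subdegree F"])
  fix i assume "i \<in> {i. vscale V (fls_nth p i) (fls_nth F (k - i)) \<noteq> 0}"
  hence "fls_nth p i \<noteq> 0" "fls_nth F (k - i) \<noteq> 0" by auto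
  hence "i \<ge> fls_subdegree p" "k - i \<ge> fls_subdegree F" by (meson fls_subdegree_leI)+
  thus "fls_subdegree p \<le> i \<and> i \<le> k - fls_subdegree F" by simp
qed

lemma nth_vmult_add:
  "fls_nth (fls_vmult V p (F + G)) k = fls_nth (fls_vmult V p F) k + fls_nth (fls_vmult V p G) k"
proof -
  have vs: "vector_space (vscale V)" by unfold_locales
  show ?thesis unfolding fls_nth_vmult[OF vs] fls_plus_nth scale_right_distrib
    by (rule Sum_any.distrib) (rule finite_vmult)+
qed

lemma nth_vmult_zero: "fls_nth (fls_vmult V p 0) k = 0"
  using nth_vmult_add[of p 0 0 k] by simp

lemma nth_vmult_const: "fls_nth (fls_vmult V (fls_const s) F) k = vscale V s (fls_nth F k)"
proof -
  have vs: "vector_space (vscale V)" by unfold_locales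
  have eq: "(\<lambda>i. vscale V (fls_nth (fls_const s) i) (fls_nth F (k - i))) = (\<lambda>i. if i = 0 then vscale V s (fls_nth F k) else 0)"
    by auto
  show ?thesis unfolding fls_nth_vmult[OF vs] eq by simp
qed

text \<open>
  The contribution $\mathrm{res}_t\,f(t)\,e^{2\pi idt}\,Y(a,e^{2\pi it}-1)\,b$ of the component of
  weight $d$ to $a_{[f]}b$.
\<close>
definition bracket_term :: "(complex \<Rightarrow> complex) \<Rightarrow> nat \<Rightarrow> 'v \<Rightarrow> 'v \<Rightarrow> 'v" where
  "bracket_term f d a b = Sum_any (\<lambda>j. vscale V (fls_nth (laurent_expansion f 0 * exp_fls (int d) * coord_fls powi j) (- 1)) (mode V a (- j - 1) b))"

lemma bracket_term_add_left: "bracket_term f d (a + a') b = bracket_term f d a b + bracket_term f d a' b"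
  unfolding bracket_term_def mode_add_left scale_right_distrib
  by (rule Sum_any.distrib) (rule finite_bracket_term)+

lemma bracket_term_add_right: "bracket_term f d a (b + b') = bracket_term f d a b + bracket_term f d a b'"
  unfolding bracket_term_def mode_add_right scale_right_distrib
  by (rule Sum_any.distrib) (rule finite_bracket_term)+

lemma bracket_term_zero [simp]: "bracket_term f d 0 b = 0"
  by (simp add: bracket_term_def)

end

context conformal_vertex_algebra
begin

lemma br_prod_eq: "br_prod V f a b = Sum_any (\<lambda>d. bracket_term f d (hcomp V a d) b)"
proof -
  have vs: "vector_space (vscale V)" by unfold_locales
  define L where "L = laurent_expansion f 0"
  define T where "T = (\<lambda>d. fls_vmult V (exp_fls (int d)) (fls_vsubst V (vop V (hcomp V a d) b) coord_fls))"
  have T0: "T d = 0" if "hcomp V a d = 0" for d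
    by (rule fls_eqI) (simp add: T_def that nth_bracket_summand)
  have "Ybr V a b = Sum_any T"
    by (simp add: Ybr_def T_def exp_fls_def coord_fls_def)
  hence "br_prod V f a b = fls_nth (fls_vmult V L (Sum_any T)) (- 1)"
    by (simp add: br_prod_def L_def)
  also have "\<dots> = Sum_any (\<lambda>d. fls_nth (fls_vmult V L (T d)) (- 1))"
    by (rule Sum_any_additive[where f = "\<lambda>F. fls_nth (fls_vmult V L F) (- 1)"])
       (use T0 in \<open>auto simp: nth_vmult_add nth_vmult_zero intro: finite_subset[OF _ hcomp(2)[of a]]\<close>)
  also have "\<dots> = Sum_any (\<lambda>d. bracket_term f d (hcomp V a d) b)"
  proof (rule arg_cong[where f = Sum_any], rule ext)
    fix d
    have "fls_nth (fls_vmult V L (T d)) (- 1) =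
        Sum_any (\<lambda>j. vscale V (fls_nth (L * (exp_fls (int d) * coord_fls powi j)) (- 1)) (fls_nth (vop V (hcomp V a d) b) j))"
      unfolding fls_nth_vmult[OF vs, of L "T d"]
      unfolding T_def nth_bracket_summand
      by (rule convolution_family) (subst fls_subdegree_mult; simp add: power_int_eq_0_iff)
    thus "fls_nth (fls_vmult V L (T d)) (- 1) = bracket_term f d (hcomp V a d) b"
      by (simp only: bracket_term_def nth_vop L_def mult.assoc)
  qed
  finally show ?thesis .
qed

lemma finite_hcomp_bracket: "finite {d. bracket_term f d (hcomp V a d) b \<noteq> 0}"
  by (rule finite_subset[OF _ hcomp(2)[of a]]) auto

lemma br_prod_add_left: "br_prod V f (a + a') b = br_prod V f a b + br_prod V f a' b"
  unfolding br_prod_eq hcomp_add bracket_term_add_left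
  by (rule Sum_any.distrib) (rule finite_hcomp_bracket)+

lemma br_prod_add_right: "br_prod V f a (b + b') = br_prod V f a b + br_prod V f a b'"
  unfolding br_prod_eq bracket_term_add_right
  by (rule Sum_any.distrib) (rule finite_hcomp_bracket)+

text \<open>
  The vectors $a_{(-j-1)}b$ that make up $a_{[f]}b$ are homogeneous of weight $p + r + j$, which
  determines the mode that occurs in the coefficient of $X$.
\<close>
lemma Xop_br_prod_homogeneous:
  assumes a: "a \<in> wt_space V p" and b: "b \<in> wt_space V r"
  shows "vscale V (2 * of_real pi * \<i>) (fls_nth (Xop V (br_prod V f a b) w) m) =
           bracket_pairing a b w (int p) (int r) m (laurent_expansion f 0)"
proof -
  define c where "c = (\<lambda>j. fls_nth (laurent_expansion f 0 * exp_fls (int p) * coord_fls powi j) (- 1))"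
  have eq: "(\<lambda>d. bracket_term f d (hcomp V a d) b) = (\<lambda>d. if d = p then bracket_term f p a b else 0)"
    by (auto simp: hcomp_homogeneous[OF a])
  have "br_prod V f a b = bracket_term f p a b" unfolding br_prod_eq eq by simp
  also have "\<dots> = Sum_any (\<lambda>j. vscale V (c j) (mode V a (- j - 1) b))"
    by (simp add: bracket_term_def c_def)
  finally have br: "br_prod V f a b = \<dots>" .
  have Xz: "fls_nth (Xop V 0 w) m = 0" using Xop_scale_left[of 0 0 w m] by simp
  have "fls_nth (Xop V (br_prod V f a b) w) m =
      Sum_any (\<lambda>j. fls_nth (Xop V (vscale V (c j) (mode V a (- j - 1) b)) w) m)"
    unfolding br
    by (rule Sum_any_additive[where f = "\<lambda>v. fls_nth (Xop V v w) m"])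
       (use finite_bracket_term in \<open>simp_all add: Xop_add_left Xz c_def\<close>)
  also have "\<dots> = Sum_any (\<lambda>j. vscale V (c j) (mode V (mode V a (- j - 1) b) (int p + int r - 2 - m + j) w))"
  proof (rule arg_cong[where f = Sum_any], rule ext)
    fix j
    have "Lop V 0 (mode V a (- j - 1) b) = vscale V (of_int (int p + int r + j)) (mode V a (- j - 1) b)"
      using mode_weight[OF a b, of "- j - 1"] by simp
    from Xop_homogeneous[OF this, of w m]
    show "fls_nth (Xop V (vscale V (c j) (mode V a (- j - 1) b)) w) m =
        vscale V (c j) (mode V (mode V a (- j - 1) b) (int p + int r - 2 - m + j) w)"
      by (simp add: Xop_scale_left algebra_simps)
  qed
  finally show ?thesis
    unfolding bracket_pairing_def
    using finite_bracket_pairing[of 1 "laurent_expansion f 0" "int p" a b "int p + int r - 2 - m" w]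
    by (simp add: Sum_any_scale_right c_def)
qed

lemma XaXb_homogeneous:
  assumes a: "a \<in> wt_space V p" and b: "b \<in> wt_space V r"
  shows "XaXb V a b w (- 1 - n) (m + n) = mode V a (int p - 1 + n) (mode V b (int r - 2 - m - n) w)"
    and "XbXa V a b w (- 1 - n) (m + n) = mode V b (int r - 2 - m - n) (mode V a (int p - 1 + n) w)"
proof -
  have X: "fls_nth (Xop V a v) i = mode V a (int p - 2 - i) v"
    "fls_nth (Xop V b v) i = mode V b (int r - 2 - i) v" for v i
    by (rule Xop_homogeneous; use a b in \<open>simp add: wt_space_def\<close>)+
  show "XaXb V a b w (- 1 - n) (m + n) = mode V a (int p - 1 + n) (mode V b (int r - 2 - m - n) w)"
    "XbXa V a b w (- 1 - n) (m + n) = mode V b (int r - 2 - m - n) (mode V a (int p - 1 + n) w)"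
    by (simp_all add: XaXb_def XbXa_def X algebra_simps)
qed

text \<open>
  The residues are Laurent series because of this bound. If $m$ is very negative, then the ranges where
  $g$ and where $h$ can be nonzero do not meet, so that one of the two products is zero for each $n$; their
  difference is a combination of finitely many $u_j$, all of which vanish.
\<close>
lemma products_vanish_below:
  "\<exists>m0. \<forall>m<m0. \<forall>n. mode V a (p - 1 + n) (mode V b (r - 2 - m - n) w) = 0 \<and>
                   mode V b (r - 2 - m - n) (mode V a (p - 1 + n) w) = 0"
proof -
  obtain K where K: "\<And>j. j \<ge> K \<Longrightarrow> mode V a j b = 0" using mode_truncation by blast
  define J where "J = nat K"
  have J: "\<And>j. j \<ge> int J \<Longrightarrow> mode V a j b = 0" by (rule K) (simp add: J_def split: if_splits)
  obtain Ka where Ka: "\<And>n. n \<ge> Ka \<Longrightarrow> mode V a n w = 0" using mode_truncation by blast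
  obtain Kb where Kb: "\<And>n. n \<ge> Kb \<Longrightarrow> mode V b n w = 0" using mode_truncation by blast
  have "\<forall>j. \<exists>K. \<forall>n\<ge>K. mode V (mode V a (int j) b) n w = 0" using mode_truncation by metis
  then obtain U where U: "\<And>j n. n \<ge> U j \<Longrightarrow> mode V (mode V a (int j) b) n w = 0" by metis
  define M where "M = Max (insert 0 (U ` {..<J}))"
  have M: "U j \<le> M" if "j < J" for j unfolding M_def using that by (intro Max_ge) auto
  define m0 where "m0 = min (p + r - 3 - int J - M) (p + r - 2 - Ka - Kb)"
  have "mode V a (p - 1 + n) (mode V b (r - 2 - m - n) w) = 0 \<and> mode V b (r - 2 - m - n) (mode V a (p - 1 + n) w) = 0"
    if m: "m < m0" for m n
  proof -
    have "mode V a (p - 1 + n) (mode V b (r - 2 - m - n) w) - mode V b (r - 2 - m - n) (mode V a (p - 1 + n) w) =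
      (\<Sum>j<J. vscale V (of_int (p - 1 + n) gchoose j)
        (mode V (mode V a (int j) b) (p - 1 + n + (r - 2 - m - n) - int j) w))"
      by (rule mode_commutator) (rule J)
    also have "\<dots> = 0"
    proof (rule sum.neutral, rule ballI)
      fix j assume "j \<in> {..<J}"
      hence "p - 1 + n + (r - 2 - m - n) - int j \<ge> U j" using M[of j] m by (simp add: m0_def)
      thus "vscale V (of_int (p - 1 + n) gchoose j)
        (mode V (mode V a (int j) b) (p - 1 + n + (r - 2 - m - n) - int j) w) = 0" by (simp only: U scale_zero_right)
    qed
    finally have eq: "mode V a (p - 1 + n) (mode V b (r - 2 - m - n) w) = mode V b (r - 2 - m - n) (mode V a (p - 1 + n) w)"
      by simp
    have "p - 1 + n \<ge> Ka \<or> r - 2 - m - n \<ge> Kb" using m by (simp add: m0_def) linarith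
    thus ?thesis using eq Ka[of "p - 1 + n"] Kb[of "r - 2 - m - n"] by auto
  qed
  thus ?thesis by blast
qed

section \<open>The commutator formula\<close>

definition residue_identity where
  "residue_identity f Fm Fp a b w \<longleftrightarrow> (\<exists>Rm Rp. res_ratio V Fm (XaXb V a b w) Rm \<and> res_ratio V Fp (XbXa V a b w) Rp \<and>
     fls_vmult V (fls_const (2 * of_real pi * \<i>)) (Xop V (br_prod V f a b) w) = Rm - Rp)"

text \<open>
  The two series are assembled from their coefficients; by uniqueness of sums, these vanish for very
  negative exponents, where all the terms are zero.
\<close>
lemma residue_identity_homogeneous:
  assumes T: "Im \<tau> > 0"
    and mero: "f meromorphic_on {0}"
    and an: "f analytic_on {t. - Im \<tau> < Im t \<and> Im t < Im \<tau>} - \<int>"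
    and Fp: "fourier_expansion f Fp (norm (e2pi \<tau>)) 1"
    and Fm: "fourier_expansion f Fm 1 (inverse (norm (e2pi \<tau>)))"
    and a: "a \<in> wt_space V p" and b: "b \<in> wt_space V r"
  shows "residue_identity f Fm Fp a b w"
proof -
  have vs: "vector_space (vscale V)" by unfold_locales
  obtain P e L0 F0 where dec:
    "laurent_expansion f 0 = L0 + (\<Sum>k=1..P. fls_const (e k) * coord_fls powi (- int k))"
    "fls_subdegree L0 \<ge> 0"
    "\<And>n. Fp n = F0 n + (\<Sum>k=1..P. e k * inner_coeff (- int k) n)"
    "\<And>n. Fm n = F0 n + (\<Sum>k=1..P. e k * outer_coeff (- int k) n)"
    "\<And>p j. ((\<lambda>n. F0 n * (of_int (p - 1 + n) gchoose j)) has_sum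
           2 * of_real pi * \<i> * fls_nth (L0 * exp_fls p * coord_fls powi (- int j - 1)) (- 1)) UNIV"
    by (rule fourier_decomposition[OF T mero an Fp Fm]) blast
  define g where "g = (\<lambda>m n. mode V a (int p - 1 + n) (mode V b (int r - 2 - m - n) w))"
  define h where "h = (\<lambda>m n. mode V b (int r - 2 - m - n) (mode V a (int p - 1 + n) w))"
  have "\<exists>S S'. has_vsum V (\<lambda>n. vscale V (Fm n) (g m n)) UNIV S \<and>
                has_vsum V (\<lambda>n. vscale V (Fp n) (h m n)) UNIV S' \<and>
                S - S' = bracket_pairing a b w (int p) (int r) m (laurent_expansion f 0)" for m
    unfolding g_def h_def by (rule mode_sums_eq_bracket_pairing[OF dec(1-5)])
  then obtain S S' where S: "\<And>m. has_vsum V (\<lambda>n. vscale V (Fm n) (g m n)) UNIV (S m)"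
    "\<And>m. has_vsum V (\<lambda>n. vscale V (Fp n) (h m n)) UNIV (S' m)"
    "\<And>m. S m - S' m = bracket_pairing a b w (int p) (int r) m (laurent_expansion f 0)" by metis
  obtain m0 where m0: "\<And>m n. m < m0 \<Longrightarrow> g m n = 0 \<and> h m n = 0"
    using products_vanish_below[of a "int p" b "int r" w] unfolding g_def h_def by blast
  have S0: "S m = 0 \<and> S' m = 0" if "m < m0" for m
  proof
    show "S m = 0"
      by (rule has_vsum_unique[OF vs S(1)[of m]]) (simp add: m0[OF that] has_vsum_zero[OF vs])
    show "S' m = 0"
      by (rule has_vsum_unique[OF vs S(2)[of m]]) (simp add: m0[OF that] has_vsum_zero[OF vs])
  qed
  define Rm where "Rm = Abs_fls S"
  define Rp where "Rp = Abs_fls S'"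
  have Rm: "fls_nth Rm m = S m" for m
    unfolding Rm_def by (rule nth_Abs_fls_lower_bound[of m0]) (use S0 in blast)
  have Rp: "fls_nth Rp m = S' m" for m
    unfolding Rp_def by (rule nth_Abs_fls_lower_bound[of m0]) (use S0 in blast)
  have "res_ratio V Fm (XaXb V a b w) Rm" "res_ratio V Fp (XbXa V a b w) Rp"
    using S(1,2) by (simp_all add: res_ratio_def XaXb_homogeneous[OF a b] Rm Rp g_def h_def)
  moreover have "fls_vmult V (fls_const (2 * of_real pi * \<i>)) (Xop V (br_prod V f a b) w) = Rm - Rp"
    by (rule fls_eqI) (simp only: nth_vmult_const Xop_br_prod_homogeneous[OF a b] fls_minus_nth Rm Rp S(3))
  ultimately show ?thesis unfolding residue_identity_def by blast
qed

lemma res_ratio_add: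
  assumes "res_ratio V F G R" "res_ratio V F G' R'"
  shows "res_ratio V F (\<lambda>i j. G i j + G' i j) (R + R')"
proof -
  have vs: "vector_space (vscale V)" by unfold_locales
  show ?thesis using assms unfolding res_ratio_def
    by (auto simp: scale_right_distrib intro: has_vsum_add[OF vs])
qed

lemma residue_identity_add:
  assumes "residue_identity f Fm Fp a b w" "residue_identity f Fm Fp a' b' w"
    and X: "XaXb V a'' b'' w = (\<lambda>i j. XaXb V a b w i j + XaXb V a' b' w i j)"
      "XbXa V a'' b'' w = (\<lambda>i j. XbXa V a b w i j + XbXa V a' b' w i j)"
    and br: "br_prod V f a'' b'' = br_prod V f a b + br_prod V f a' b'"
  shows "residue_identity f Fm Fp a'' b'' w"
proof -
  obtain Rm Rp Rm' Rp' where R: "res_ratio V Fm (XaXb V a b w) Rm" "res_ratio V Fp (XbXa V a b w) Rp"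
    "fls_vmult V (fls_const (2 * of_real pi * \<i>)) (Xop V (br_prod V f a b) w) = Rm - Rp"
    "res_ratio V Fm (XaXb V a' b' w) Rm'" "res_ratio V Fp (XbXa V a' b' w) Rp'"
    "fls_vmult V (fls_const (2 * of_real pi * \<i>)) (Xop V (br_prod V f a' b') w) = Rm' - Rp'"
    using assms(1,2) unfolding residue_identity_def by blast
  have "fls_vmult V (fls_const (2 * of_real pi * \<i>)) (Xop V (br_prod V f a'' b'') w) = (Rm - Rp) + (Rm' - Rp')"
    unfolding R(3,6)[symmetric] br
    by (rule fls_eqI) (simp add: nth_vmult_const Xop_add_left scale_right_distrib)
  hence "fls_vmult V (fls_const (2 * of_real pi * \<i>)) (Xop V (br_prod V f a'' b'') w) = (Rm + Rm') - (Rp + Rp')"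
    by simp
  thus ?thesis unfolding residue_identity_def X using R by (blast intro: res_ratio_add)
qed

lemma residue_identity_add_left:
  assumes "residue_identity f Fm Fp a b w" "residue_identity f Fm Fp a' b w"
  shows "residue_identity f Fm Fp (a + a') b w"
  using assms
  by (rule residue_identity_add)
     (simp_all add: fun_eq_iff XaXb_def XbXa_def Xop_add_left Xop_add_right br_prod_add_left)

lemma residue_identity_add_right:
  assumes "residue_identity f Fm Fp a b w" "residue_identity f Fm Fp a b' w"
  shows "residue_identity f Fm Fp a (b + b') w"
  using assms
  by (rule residue_identity_add)
     (simp_all add: fun_eq_iff XaXb_def XbXa_def Xop_add_left Xop_add_right br_prod_add_right)

lemma homogeneous_additive_induct:
  assumes hom: "\<And>p x. x \<in> wt_space V p \<Longrightarrow> Q x" and add: "\<And>x y. Q x \<Longrightarrow> Q y \<Longrightarrow> Q (x + y)"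
  shows "Q v"
proof -
  have "Q (\<Sum>d\<in>D. hcomp V v d)" for D
    by (induction D rule: infinite_finite_induct) (auto intro: hom add hcomp(1) wt_space_zero[of 0])
  from this[of "{d. hcomp V v d \<noteq> 0}"] show ?thesis
    using hcomp(3)[of v] by (simp add: Sum_any.expand_set)
qed

lemma residue_identity:
  assumes T: "Im \<tau> > 0"
    and mero: "f meromorphic_on {0}"
    and an: "f analytic_on {t. - Im \<tau> < Im t \<and> Im t < Im \<tau>} - \<int>"
    and Fp: "fourier_expansion f Fp (norm (e2pi \<tau>)) 1"
    and Fm: "fourier_expansion f Fm 1 (inverse (norm (e2pi \<tau>)))"
  shows "residue_identity f Fm Fp a b w"
proof (rule homogeneous_additive_induct[of "\<lambda>a. residue_identity f Fm Fp a b w"])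
  fix p a assume a: "a \<in> wt_space V p"
  show "residue_identity f Fm Fp a b w"
    by (rule homogeneous_additive_induct[of "\<lambda>b. residue_identity f Fm Fp a b w"])
       (blast intro: residue_identity_homogeneous[OF assms a] residue_identity_add_right)+
qed (rule residue_identity_add_left)

text \<open>
  The residue of a linear family is linear, since sums are unique.
\<close>
lemma res_ratio_hom_laurent:
  assumes R: "\<And>w. res_ratio V F (G w) (R w)"
    and add: "\<And>x y i j. G (x + y) i j = G x i j + G y i j"
    and scale: "\<And>s x i j. G (vscale V s x) i j = vscale V s (G x i j)"
  shows "R \<in> hom_laurent V"
proof -
  have vs: "vector_space (vscale V)" by unfold_locales
  have R': "has_vsum V (\<lambda>n. vscale V (F n) (G w (- 1 - n) (m + n))) UNIV (fls_nth (R w) m)" for w m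
    using R unfolding res_ratio_def by blast
  have "fls_nth (R (x + y)) m = fls_nth (R x) m + fls_nth (R y) m" for x y m
    using has_vsum_add[OF vs R' R', of x m y m] R'[of "x + y" m]
    by (intro has_vsum_unique[OF vs]) (simp_all add: add scale_right_distrib)
  moreover have "fls_nth (R (vscale V s x)) m = vscale V s (fls_nth (R x) m)" for s x m
    using has_vsum_scale[OF vs R', of s x m] R'[of "vscale V s x" m]
    by (intro has_vsum_unique[OF vs]) (simp_all add: scale mult.commute)
  ultimately show ?thesis
    unfolding hom_laurent_def Vector_Spaces.linear_iff using vs by simp
qed

end

theorem theorem7p3:
  fixes V :: "('v :: ab_group_add) vertex_data"
    and a b :: 'v
    and f :: "complex \<Rightarrow> complex"
    and \<tau> :: complex
    and Fp Fm :: "int \<Rightarrow> complex"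
  assumes "conformal_vertex_algebra V"
    and "f meromorphic_on UNIV"
    and "\<forall>\<^sub>\<approx>t. f (t + 1) = f t"
    and "Im \<tau> > 0"
    and "f analytic_on {t. - Im \<tau> < Im t \<and> Im t < Im \<tau>} - \<int>"
    and "fourier_expansion f Fp (norm (e2pi \<tau>)) 1"
    and "fourier_expansion f Fm 1 (inverse (norm (e2pi \<tau>)))"
    and "\<not> is_pole f 0 \<or> (\<exists>\<alpha>. \<forall>\<^sub>\<approx>t. f (t + \<tau>) = f t - \<alpha>)"
  shows "\<exists>Rm\<in>hom_laurent V. \<exists>Rp\<in>hom_laurent V.
           (\<forall>c. res_ratio V Fm (XaXb V a b c) (Rm c)) \<and>
           (\<forall>c. res_ratio V Fp (XbXa V a b c) (Rp c)) \<and>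
           (\<forall>c. fls_vmult V (fls_const (2 * of_real pi * \<i>)) (Xop V (br_prod V f a b) c) =
                  Rm c - Rp c)"
proof -
  interpret conformal_vertex_algebra V by fact
  have "f meromorphic_on {0}" by (rule meromorphic_on_subset[OF assms(2)]) simp
  hence "residue_identity f Fm Fp a b c" for c
    by (rule residue_identity[OF assms(4) _ assms(5-7)])
  then obtain Rm Rp where R: "\<And>c. res_ratio V Fm (XaXb V a b c) (Rm c)"
      "\<And>c. res_ratio V Fp (XbXa V a b c) (Rp c)"
      "\<And>c. fls_vmult V (fls_const (2 * of_real pi * \<i>)) (Xop V (br_prod V f a b) c) = Rm c - Rp c"
    unfolding residue_identity_def by metis
  have "Rm \<in> hom_laurent V"
    by (rule res_ratio_hom_laurent[OF R(1)]) (simp_all add: XaXb_def Xop_add_right Xop_scale_right)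
  moreover have "Rp \<in> hom_laurent V"
    by (rule res_ratio_hom_laurent[OF R(2)]) (simp_all add: XbXa_def Xop_add_right Xop_scale_right)
  ultimately show ?thesis using R by blast
qed

end
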